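(* Let $D$ be a weighted oriented graph with underlying simple graph $G$ such that $I(D)$ has homological linear quotients. Then $I(G)$ has homological linear quotients.
   Context: $R=\mathbb{K}[x_1,\dots,x_n]$ over a field $\mathbb{K}$. A weighted oriented graph $D$ on $V(D)=\{x_1,\dots,x_n\}$ is a finite simple graph $G$ (the underlying graph) in which each edge is given exactly one orientation, with a weight function $w:V(D)\to\{1,2,\dots\}$, $w_i=w(x_i)$; sources (vertices with no incoming edge) are assumed to have weight $1$. The edge ideal is $I(D)=(x_ix_j^{w_j} : (x_i,x_j)\in E(D))\subseteq R$, where $(x_i,x_j)$ denotes an edge oriented $x_i\to x_j$, and $I(G)=(x_ix_j:\{x_i,x_j\}\in E(G))$. A monomial ideal $J$ with minimal monomial generating set $\mathcal{G}(J)$ has linear quotients if there is an order $u_1<\dots<u_m$ of $\mathcal{G}(J)$ such that $(u_1,\dots,u_{i-1}):u_i$ is generated by a subset of the variables for $i=2,\dots,m$ (the zero ideal has linear quotients). The $k$th homological shift ideal is $HS_k(J)=(\mathbf{x}^{\mathbf{a}} : \beta_{k,\mathbf{a}}(J)\ne 0)$, where $\beta_{k,\mathbf{a}}(J)$ are the multigraded Betti numbers of the minimal $\mathbb{N}^n$-graded free resolution of $J$. $J$ has homological linear quotients if $HS_k(J)$ has linear quotients for every $k\ge 0$. *)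

theory Defs
  imports
    "HOL-Library.Poly_Mapping"
    "Jordan_Normal_Form.Matrix_Kernel"
begin

section \<open>Monomials and ideals of the polynomial ring\<close>

text \<open>
  The variables are indexed by a finite type \<open>'v\<close>. The type \<open>'v \<Rightarrow>\<^sub>0 nat\<close> is the monoid of exponent
  vectors, and its monoid ring \<open>('v \<Rightarrow>\<^sub>0 nat) \<Rightarrow>\<^sub>0 'k\<close> is the polynomial ring over \<open>'k\<close>, with
  convolution as multiplication.
\<close>

type_synonym 'v expo = "'v \<Rightarrow>\<^sub>0 nat"
type_synonym ('v, 'k) mpoly = "'v expo \<Rightarrow>\<^sub>0 'k"

definition xpow :: "'v expo \<Rightarrow> ('v, 'k::field) mpoly"
  where "xpow a = Poly_Mapping.single a 1"

definition Var :: "'v \<Rightarrow> ('v, 'k::field) mpoly"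
  where "Var i = xpow (Poly_Mapping.single i 1)"

definition ideal_gen :: "('v, 'k::field) mpoly set \<Rightarrow> ('v, 'k) mpoly set"
  where "ideal_gen S = module.span (*) S"

definition ideal_colon :: "('v, 'k::field) mpoly set \<Rightarrow> ('v, 'k) mpoly \<Rightarrow> ('v, 'k) mpoly set"
  where "ideal_colon I u = {f. f * u \<in> I}"

definition min_monomial_gens :: "('v, 'k::field) mpoly set \<Rightarrow> ('v, 'k) mpoly set \<Rightarrow> bool"
  where "min_monomial_gens A J \<longleftrightarrow>
    A \<subseteq> range xpow \<and> ideal_gen A = J \<and> (\<forall>B. B \<subset> A \<longrightarrow> ideal_gen B \<noteq> J)"

definition linear_quotients :: "('v, 'k::field) mpoly set \<Rightarrow> bool"
  where "linear_quotients J \<longleftrightarrow>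
    (\<exists>us. distinct us \<and> min_monomial_gens (set us) J \<and>
      (\<forall>i. 0 < i \<and> i < length us \<longrightarrow>
        (\<exists>S. ideal_colon (ideal_gen (set (take i us))) (us ! i) = ideal_gen (Var ` S))))"


section \<open>Multigraded Betti numbers and homological shift ideals\<close>

text \<open>
  A finitely generated multigraded free module \<open>R(-a\<^sub>0) \<oplus> \<dots> \<oplus> R(-a\<^sub>r)\<close> is encoded by the list
  \<open>[a\<^sub>0, \<dots>, a\<^sub>r]\<close> of the degrees of its basis elements, and a map between two such modules by its
  matrix. The map is homogeneous of degree 0 iff every term of the entry in row \<open>p\<close> and
  column \<open>q\<close> has as degree the difference of the degrees of the basis elements \<open>q\<close> and \<open>p\<close>; in
  particular this entry is 0 if that difference is not in \<open>\<nat>\<^sup>n\<close>.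
\<close>

definition graded_map :: "'v expo list \<Rightarrow> 'v expo list \<Rightarrow> ('v, 'k::field) mpoly mat \<Rightarrow> bool"
  where "graded_map source target A \<longleftrightarrow>
    A \<in> carrier_mat (length target) (length source) \<and>
    (\<forall>p < length target. \<forall>q < length source.
      \<forall>m \<in> Poly_Mapping.keys (A $$ (p, q)). target ! p + m = source ! q)"

definition mat_image :: "'a::comm_ring_1 mat \<Rightarrow> 'a vec set"
  where "mat_image A = {A *\<^sub>v v |v. v \<in> carrier_vec (dim_col A)}"

text \<open>
  \<open>\<dots> \<rightarrow> F 2 \<rightarrow> F 1 \<rightarrow> F 0 \<rightarrow> J \<rightarrow> 0\<close>, where \<open>d (Suc i) : F (Suc i) \<rightarrow> F i\<close>. The augmentation
  \<open>d 0 : F 0 \<rightarrow> J\<close> is given as a map into \<open>R\<close> with image \<open>J\<close>, that is, as a matrix with one row. It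
  is exempt from the minimality condition.
\<close>

definition min_graded_free_resolution ::
  "(nat \<Rightarrow> 'v expo list) \<Rightarrow> (nat \<Rightarrow> ('v, 'k::field) mpoly mat) \<Rightarrow> ('v, 'k) mpoly set \<Rightarrow> bool"
  where "min_graded_free_resolution F d J \<longleftrightarrow>
    graded_map (F 0) [0] (d 0) \<and>
    (\<forall>i. graded_map (F (Suc i)) (F i) (d (Suc i))) \<and>
    (\<lambda>v. v $ 0) ` mat_image (d 0) = J \<and>
    (\<forall>i. mat_image (d (Suc i)) = mat_kernel (d i)) \<and>
    (\<forall>i. elements_mat (d (Suc i)) \<subseteq> ideal_gen (range Var))"

text \<open>
  Every monomial ideal has a minimal graded free resolution, and any two are isomorphic as graded
  complexes, so the choice made here does not matter.
\<close>

definition betti :: "('v, 'k::field) mpoly set \<Rightarrow> nat \<Rightarrow> 'v expo \<Rightarrow> nat"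
  where "betti J k a =
    count_list ((SOME F. \<exists>d. min_graded_free_resolution F d J) k) a"

definition homological_shift_ideal :: "nat \<Rightarrow> ('v, 'k::field) mpoly set \<Rightarrow> ('v, 'k) mpoly set"
  where "homological_shift_ideal k J = ideal_gen {xpow a |a. betti J k a \<noteq> 0}"

definition homological_linear_quotients :: "('v, 'k::field) mpoly set \<Rightarrow> bool"
  where "homological_linear_quotients J \<longleftrightarrow> (\<forall>k. linear_quotients (homological_shift_ideal k J))"


section \<open>Weighted oriented graphs\<close>

text \<open>
  The vertex set is the whole type \<open>'v\<close>; \<open>(x, y) \<in> E\<close> is the edge oriented from \<open>x\<close> to \<open>y\<close>.
\<close>

definition weighted_oriented_graph :: "('v::finite \<times> 'v) set \<Rightarrow> ('v \<Rightarrow> nat) \<Rightarrow> bool"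
  where "weighted_oriented_graph E w \<longleftrightarrow>
    (\<forall>x. (x, x) \<notin> E) \<and>
    (\<forall>x y. (x, y) \<in> E \<longrightarrow> (y, x) \<notin> E) \<and>
    (\<forall>x. 1 \<le> w x) \<and>
    (\<forall>x. (\<forall>y. (y, x) \<notin> E) \<longrightarrow> w x = 1)"

definition underlying_graph :: "('v \<times> 'v) set \<Rightarrow> 'v set set"
  where "underlying_graph E = {{x, y} |x y. (x, y) \<in> E}"

definition oriented_edge_ideal :: "('v \<times> 'v) set \<Rightarrow> ('v \<Rightarrow> nat) \<Rightarrow> ('v, 'k::field) mpoly set"
  where "oriented_edge_ideal E w = ideal_gen {Var x * Var y ^ w y |x y. (x, y) \<in> E}"

definition edge_ideal :: "'v set set \<Rightarrow> ('v, 'k::field) mpoly set"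
  where "edge_ideal G = ideal_gen {Var x * Var y |x y. {x, y} \<in> G}"

end

theory Submission
  imports Defs
begin

text \<open>
  Let \<open>u\<^sub>1, \<dots>, u\<^sub>m\<close> be a linear quotient order of \<open>I(D)\<close> and \<open>S\<^sub>i\<close> the variables generating the
  \<open>i\<close>-th colon ideal. A variable of \<open>S\<^sub>i\<close> dividing \<open>u\<^sub>i\<close> would produce an earlier generator with the
  same support as \<open>u\<^sub>i\<close>, so \<open>S\<^sub>i\<close> is disjoint from the support of \<open>u\<^sub>i\<close>, and the radicals of the
  \<open>u\<^sub>i\<close> form a linear quotient order of \<open>I(G)\<close> with the same sets \<open>S\<^sub>i\<close>. Iterated mapping cones give
  resolutions of both ideals with degrees \<open>u\<^sub>i x\<^sub>A\<close> and \<open>rad(u\<^sub>i) x\<^sub>A\<close>, where \<open>A \<subseteq> S\<^sub>i\<close> and \<open>|A| = k\<close>;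
  they are minimal because all degrees in homological degree \<open>k\<close> have support of size \<open>k + 2\<close>.
  Hence the degrees for \<open>I(G)\<close> are the radicals of those for \<open>I(D)\<close>, and, the supports having constant
  size, taking radicals and dropping repetitions turns a linear quotient order of \<open>HS\<^sub>k(I(D))\<close> into
  one of \<open>HS\<^sub>k(I(G))\<close>.
\<close>

section \<open>Exponent vectors and monomial ideals\<close>

text \<open>\<open>betti\<close> refers to a resolution picked by \<open>SOME\<close>, so computing
  shift ideals takes two general facts. Uniqueness: two minimal resolutions of an ideal have the
  same set of degrees, so any explicit one determines the shift ideals; multiplicities do not enter.
  Existence: the hypothesis speaks of shift ideals only, and to read its case k = 0 as linear
  quotients of the ideal itself, a minimal resolution must be available before any order of the
  generators is known. This is why arbitrary monomial ideals are resolved; all other resolutions are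
  explicit cones. The combinatorial half rests on one observation: divisibility between monomials
  whose supports have equal size forces equal supports. For edge ideals the size is two, and since
  no edge carries both orientations, the support determines the oriented edge. Taking radicals is
  therefore injective on generators; injectivity is used only there and not in higher homological
  degrees.\<close>

abbreviation "lookup \<equiv> Poly_Mapping.lookup"
abbreviation "keys \<equiv> Poly_Mapping.keys"

definition edvd :: "'v expo \<Rightarrow> 'v expo \<Rightarrow> bool"
  where "edvd a b \<longleftrightarrow> (\<forall>p. lookup a p \<le> lookup b p)"

lemma edvd_refl [simp]: "edvd a a"
  by (simp add: edvd_def)

lemma edvd_trans: "edvd a b \<Longrightarrow> edvd b c \<Longrightarrow> edvd a c"
  by (meson edvd_def le_trans)

lemma edvd_antisym: "edvd a b \<Longrightarrow> edvd b a \<Longrightarrow> a = b"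
  by (auto simp: edvd_def intro!: poly_mapping_eqI le_antisym)

lemma edvd_add [simp]: "edvd a (a + b)"
  by (simp add: edvd_def lookup_add)

lemma edvd_add_diff: "edvd a b \<Longrightarrow> a + (b - a) = b"
  by (intro poly_mapping_eqI) (simp add: edvd_def lookup_add lookup_minus)

lemma edvd_iff: "edvd a b \<longleftrightarrow> (\<exists>c. b = a + c)"
  by (metis edvd_add edvd_add_diff)

lemma edvd_single: "edvd (Poly_Mapping.single p 1) m \<longleftrightarrow> lookup m p \<noteq> 0"
  by (auto simp: edvd_def lookup_single when_def)

lemma edvd_keys_mono: "edvd a b \<Longrightarrow> keys a \<subseteq> keys b"
  by (auto simp: edvd_def in_keys_iff) (metis gr0I leD)

lemma lookup_single_mult:
  fixes g :: "('v, 'k::field) mpoly"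
  shows "lookup (Poly_Mapping.single m x * g) n = (if edvd m n then x * lookup g (n - m) else 0)"
proof -
  have "lookup (Poly_Mapping.single m x * g) n =
      Sum_any (\<lambda>l. (x * Sum_any (\<lambda>q. lookup g q when n = l + q)) when m = l)"
    unfolding lookup_mult lookup_single by (simp add: when_mult)
  also have "\<dots> = x * Sum_any (\<lambda>q. lookup g q when n = m + q)"
    by simp
  also have "\<dots> = (if edvd m n then x * lookup g (n - m) else 0)"
  proof (cases "edvd m n")
    case True
    then have "n = m + q \<longleftrightarrow> n - m = q" for q
      using edvd_add_diff[OF True] by (metis add_diff_cancel_left')
    then show ?thesis using True by simp
  next
    case False
    then have "\<And>q. (n = m + q) = False"
      by (auto simp: edvd_iff)
    then show ?thesis using False by simp
  qed
  finally show ?thesis .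
qed

text \<open>Exponents are natural numbers, so 0 is a sum of zeros only. Taking constant terms is
  thus multiplicative: it is reduction modulo the ideal of all variables, through which the
  minimality arguments run.\<close>

lemma lookup_mult_0:
  fixes f g :: "('v, 'k::field) mpoly"
  shows "lookup (f * g) 0 = lookup f 0 * lookup g 0"
proof -
  have *: "0 = l + q \<longleftrightarrow> l = 0 \<and> q = 0" for l q :: "'v expo"
  proof
    assume "0 = l + q"
    then have "lookup l p + lookup q p = 0" for p
      by (metis lookup_add lookup_zero)
    then show "l = 0 \<and> q = 0"
      by (auto intro: poly_mapping_eqI)
  qed simp
  have "Sum_any (\<lambda>q. lookup g q when 0 = l + q) = (lookup g 0 when l = 0)" for l
    unfolding * by (cases "l = 0") simp_all
  then show ?thesis
    by (simp add: lookup_mult mult_when)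
qed

lemma sum_single_keys:
  "(\<Sum>m\<in>keys f. Poly_Mapping.single m (lookup f m)) = f"
  by (rule poly_mapping_eqI)
    (auto simp: lookup_sum lookup_single when_def in_keys_iff sum.delta)

global_interpretation poly_module: module "(*) :: ('v, 'k::field) mpoly \<Rightarrow> _"
  by unfold_locales (auto simp: algebra_simps)

text \<open>Such a termwise condition defines an ideal, and a polynomial is the sum of its terms.
  Later questions about monomial ideals thereby become questions about divisibility of exponent
  vectors.\<close>

lemma ideal_gen_xpow:
  "ideal_gen (xpow ` U :: ('v, 'k::field) mpoly set) = {f. \<forall>m \<in> keys f. \<exists>u \<in> U. edvd u m}"
  (is "_ = ?R")
proof
  have "poly_module.subspace ?R"
  proof (rule poly_module.subspaceI)
    fix x y :: "('v, 'k) mpoly" assume "x \<in> ?R" "y \<in> ?R"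
    then show "x + y \<in> ?R"
      using keys_add[of x y] by (simp add: subset_iff) blast
  next
    fix c x :: "('v, 'k) mpoly" assume x: "x \<in> ?R"
    show "c * x \<in> ?R"
    proof safe
      fix m assume "m \<in> keys (c * x)"
      then obtain a b where ab: "m = b + a" "b \<in> keys x"
        using keys_mult[of c x] by (auto simp: add.commute)
      then obtain u where "u \<in> U" "edvd u b"
        using x by blast
      then show "\<exists>u\<in>U. edvd u m"
        using ab(1) edvd_add edvd_trans by blast
    qed
  qed simp
  moreover have "xpow ` U \<subseteq> ?R"
    by (auto simp: xpow_def) (use edvd_refl in blast)
  ultimately show "ideal_gen (xpow ` U) \<subseteq> ?R"
    unfolding ideal_gen_def by (rule poly_module.span_minimal[rotated])
next
  show "?R \<subseteq> ideal_gen (xpow ` U)"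
  proof
    fix f :: "('v, 'k) mpoly" assume f: "f \<in> ?R"
    have "(\<Sum>m\<in>keys f. Poly_Mapping.single m (lookup f m)) \<in> poly_module.span (xpow ` U)"
    proof (rule poly_module.span_sum)
      fix m assume "m \<in> keys f"
      then obtain u where u: "u \<in> U" "edvd u m" using f by blast
      then have "Poly_Mapping.single m (lookup f m) =
          Poly_Mapping.single (m - u) (lookup f m) * xpow u"
        by (simp add: xpow_def mult_single add.commute edvd_add_diff)
      then show "Poly_Mapping.single m (lookup f m) \<in> poly_module.span (xpow ` U)"
        using u(1) by (simp add: poly_module.span_base poly_module.span_scale)
    qed
    then show "f \<in> ideal_gen (xpow ` U)"
      by (simp add: sum_single_keys ideal_gen_def)
  qed
qed

lemma ideal_gen_Var:
  "ideal_gen (Var ` S :: ('v, 'k::field) mpoly set) = {f. \<forall>m \<in> keys f. \<exists>p \<in> S. lookup m p \<noteq> 0}"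
proof -
  have "Var ` S = (xpow ` (\<lambda>p. Poly_Mapping.single p 1) ` S :: ('v, 'k) mpoly set)"
    by (auto simp: Var_def image_image)
  then show ?thesis
    by (simp add: ideal_gen_xpow edvd_single[unfolded One_nat_def])
qed

lemma ideal_gen_range_Var:
  "ideal_gen (range Var :: ('v, 'k::field) mpoly set) = {f. lookup f 0 = 0}"
proof -
  have "(\<exists>p. lookup m p \<noteq> 0) \<longleftrightarrow> m \<noteq> 0" for m :: "'v expo"
    by (metis lookup_zero poly_mapping_eqI)
  then show ?thesis
    by (auto simp: ideal_gen_Var in_keys_iff)
qed

lemma xpow_in_ideal_gen:
  "(xpow m :: ('v, 'k::field) mpoly) \<in> ideal_gen (xpow ` U) \<longleftrightarrow> (\<exists>u \<in> U. edvd u m)"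
  by (auto simp: ideal_gen_xpow) (auto simp: xpow_def)

lemma ideal_colon_xpow:
  "ideal_colon (ideal_gen (xpow ` U)) (xpow v :: ('v, 'k::field) mpoly) =
    {f. \<forall>m \<in> keys f. \<exists>u \<in> U. edvd u (v + m)}"
proof -
  have "keys (f * xpow v) = (+) v ` keys f" for f :: "('v, 'k) mpoly"
  proof -
    have "lookup (f * xpow v) n = (if edvd v n then lookup f (n - v) else 0)" for n
      unfolding mult.commute[of f] xpow_def by (simp add: lookup_single_mult)
    then have "n \<in> keys (f * xpow v) \<longleftrightarrow> edvd v n \<and> n - v \<in> keys f" for n
      by (simp add: in_keys_iff)
    then show ?thesis
      by (auto simp: edvd_iff image_iff)
  qed
  then show ?thesis
    by (auto simp: ideal_colon_def ideal_gen_xpow)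
qed

section \<open>Homogeneous components\<close>

text \<open>With \<open>f\<close> the coefficient of a basis element of degree \<open>a\<close>,
  this is the part of \<open>f\<close> contributing to degree \<open>b\<close>; it has at most one
  term. The test of divisibility is there because subtraction of exponents is truncated.\<close>

definition hpart :: "'v expo \<Rightarrow> 'v expo \<Rightarrow> ('v, 'k::field) mpoly \<Rightarrow> ('v, 'k) mpoly"
  where "hpart a b f = (if edvd a b then Poly_Mapping.single (b - a) (lookup f (b - a)) else 0)"

lemma lookup_hpart: "lookup (hpart a b f) m = (if a + m = b then lookup f m else 0)"
  by (auto simp: hpart_def lookup_single when_def edvd_add_diff) (metis edvd_add)

lemma keys_hpart: "m \<in> keys (hpart a b f) \<Longrightarrow> a + m = b"
  by (simp add: in_keys_iff lookup_hpart split: if_splits)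

lemma hpart_self: "\<forall>m \<in> keys f. a + m = b \<Longrightarrow> hpart a b f = f"
  by (rule poly_mapping_eqI) (auto simp: lookup_hpart in_keys_iff)

lemma hpart_sum: "hpart a b (sum f I) = (\<Sum>i\<in>I. hpart a b (f i))"
  by (rule poly_mapping_eqI) (simp add: lookup_hpart lookup_sum)

lemma hpart_zero [simp]: "hpart a b 0 = 0"
  by (rule poly_mapping_eqI) (simp add: lookup_hpart)

text \<open>A homogeneous matrix entry has at most one term, so multiplying by it commutes with
  extracting a component. This turns arbitrary solutions of linear systems into graded ones.\<close>

lemma mult_hpart:
  assumes "\<forall>m \<in> keys f. a + m = b"
  shows "f * hpart b c g = hpart a c (f * g)"
proof (cases "f = 0")
  case False
  then obtain m where m: "m \<in> keys f"
    using poly_mapping_eqI[of f 0] by (auto simp: in_keys_iff)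
  then have b: "b = a + m" using assms by auto
  obtain x where f: "f = Poly_Mapping.single m x"
    using hpart_self[OF assms] by (metis add_diff_cancel_left' b edvd_add hpart_def)
  show ?thesis
  proof (rule poly_mapping_eqI)
    fix n
    show "lookup (f * hpart b c g) n = lookup (hpart a c (f * g)) n"
      unfolding lookup_hpart f lookup_single_mult b
      by (auto simp: edvd_iff add.assoc)
  qed
qed auto

lemma sum_hpart:
  assumes "finite B" "\<And>m. m \<in> keys f \<Longrightarrow> a + m \<in> B"
  shows "(\<Sum>b\<in>B. hpart a b f) = f"
  by (rule poly_mapping_eqI) (use assms in \<open>auto simp: lookup_sum lookup_hpart in_keys_iff\<close>)

section \<open>Graded maps and uniqueness of minimal resolutions\<close>

lemma graded_map_carrier: "graded_map F G A \<Longrightarrow> A \<in> carrier_mat (length G) (length F)"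
  by (simp add: graded_map_def)

lemma graded_mapI:
  assumes "A \<in> carrier_mat (length G) (length F)"
    and "\<And>p q m. p < length G \<Longrightarrow> q < length F \<Longrightarrow> m \<in> keys (A $$ (p, q)) \<Longrightarrow> G ! p + m = F ! q"
  shows "graded_map F G A"
  using assms by (simp add: graded_map_def)

lemma graded_mapD:
  "graded_map F G A \<Longrightarrow> p < length G \<Longrightarrow> q < length F \<Longrightarrow> \<forall>m \<in> keys (A $$ (p, q)). G ! p + m = F ! q"
  by (simp add: graded_map_def)

lemma index_mult_mat_sum:
  assumes "A \<in> carrier_mat l m" "B \<in> carrier_mat m n" "i < l" "j < n"
  shows "(A * B) $$ (i, j) = (\<Sum>p<m. A $$ (i, p) * B $$ (p, j))"
  using assms by (simp add: scalar_prod_def lessThan_atLeast0)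

lemma index_mult_vec_sum:
  assumes "A \<in> carrier_mat l m" "v \<in> carrier_vec m" "i < l"
  shows "(A *\<^sub>v v) $ i = (\<Sum>p<m. A $$ (i, p) * v $ p)"
  using assms by (simp add: scalar_prod_def lessThan_atLeast0)

lemma graded_map_mult:
  assumes "graded_map G H B" "graded_map F G A"
  shows "graded_map F H (B * A)"
proof (rule graded_mapI)
  note c = assms[THEN graded_map_carrier]
  then show "B * A \<in> carrier_mat (length H) (length F)" by simp
  fix p q m assume pq: "p < length H" "q < length F" and "m \<in> keys ((B * A) $$ (p, q))"
  then obtain r where r: "r < length G" "m \<in> keys (B $$ (p, r) * A $$ (r, q))"
    using keys_sum[of "\<lambda>r. B $$ (p, r) * A $$ (r, q)" "{..<length G}"]
    by (auto simp: index_mult_mat_sum[OF c])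
  then obtain a b where "m = a + b" "a \<in> keys (B $$ (p, r))" "b \<in> keys (A $$ (r, q))"
    using keys_mult by blast
  then show "H ! p + m = F ! q"
    using graded_mapD[OF assms(1) pq(1) r(1)] graded_mapD[OF assms(2) r(1) pq(2)]
    by (metis add.assoc)
qed

lemma graded_map_minus:
  assumes "graded_map F G A" "graded_map F G B"
  shows "graded_map F G (A - B)"
proof (rule graded_mapI)
  note c = assms[THEN graded_map_carrier]
  then show "A - B \<in> carrier_mat (length G) (length F)" by (simp add: minus_carrier_mat)
  fix p q m assume pq: "p < length G" "q < length F" and "m \<in> keys ((A - B) $$ (p, q))"
  then have "m \<in> keys (A $$ (p, q)) \<or> m \<in> keys (B $$ (p, q))"
    using c by (auto simp: in_keys_iff lookup_minus)
  then show "G ! p + m = F ! q"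
    using graded_mapD[OF assms(1) pq] graded_mapD[OF assms(2) pq] by auto
qed

lemma graded_map_one: "graded_map F F (1\<^sub>m (length F) :: ('v, 'k::field) mpoly mat)"
  by (rule graded_mapI) (auto split: if_splits simp: when_def)

lemma mat_imageI: "v \<in> carrier_vec (dim_col A) \<Longrightarrow> A *\<^sub>v v \<in> mat_image A"
  by (auto simp: mat_image_def)

lemma col_in_mat_image: "q < dim_col A \<Longrightarrow> col A q \<in> mat_image (A :: 'a::comm_ring_1 mat)"
proof -
  assume q: "q < dim_col A"
  then have "A *\<^sub>v unit_vec (dim_col A) q = col A q"
    by (intro eq_vecI) (auto simp: scalar_prod_right_unit)
  then show ?thesis
    by (metis mat_imageI unit_vec_carrier)
qed

lemma mat_image_mult:
  assumes "A \<in> carrier_mat l m" "B \<in> carrier_mat m n"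
  shows "mat_image (A * B) \<subseteq> mat_image A"
  using assms unfolding mat_image_def by auto

lemma mat_image_subset_kernel_iff:
  assumes "A \<in> carrier_mat l m" "B \<in> carrier_mat m n"
  shows "mat_image B \<subseteq> mat_kernel A \<longleftrightarrow> A * B = 0\<^sub>m l n"
proof
  assume *: "mat_image B \<subseteq> mat_kernel A"
  have "col (A * B) q = col (0\<^sub>m l n) q" if "q < n" for q
  proof -
    have "col B q \<in> mat_kernel A"
      using * col_in_mat_image[of q B] assms that by auto
    then have "A *\<^sub>v col B q = 0\<^sub>v l"
      using mat_kernelD[OF assms(1)] by blast
    then show ?thesis
      using assms that by (metis col_mult2 col_zero)
  qed
  then show "A * B = 0\<^sub>m l n"
    using assms by (intro mat_col_eqI) auto
next
  assume *: "A * B = 0\<^sub>m l n"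
  show "mat_image B \<subseteq> mat_kernel A"
  proof
    fix v assume "v \<in> mat_image B"
    then obtain w where w: "w \<in> carrier_vec n" "v = B *\<^sub>v w"
      using assms by (auto simp: mat_image_def)
    have "A *\<^sub>v v = 0\<^sub>m l n *\<^sub>v w"
      using * w assoc_mult_mat_vec[OF assms w(1)] by simp
    also have "\<dots> = 0\<^sub>v l"
      using w(1) by (intro eq_vecI) auto
    finally have "A *\<^sub>v v = 0\<^sub>v l" .
    then show "v \<in> mat_kernel A"
      using assms w by (intro mat_kernelI[OF assms(1)]) auto
  qed
qed

text \<open>A solution of \<open>D * Y = X\<close> with arbitrary columns becomes graded by taking homogeneous
  components.\<close>

lemma graded_lift:
  fixes X D :: "('v, 'k::field) mpoly mat"
  assumes X: "graded_map F G X" and D: "graded_map H G D" and im: "mat_image X \<subseteq> mat_image D"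
  obtains Y where "graded_map F H Y" "D * Y = X"
proof -
  note cX = graded_map_carrier[OF X] and cD = graded_map_carrier[OF D]
  have "\<exists>v. v \<in> carrier_vec (length H) \<and> D *\<^sub>v v = col X q" if "q < length F" for q
    using im col_in_mat_image[of q X] cX cD that by (force simp: mat_image_def)
  then obtain v where v: "\<And>q. q < length F \<Longrightarrow> v q \<in> carrier_vec (length H) \<and> D *\<^sub>v v q = col X q"
    by metis
  define Y where "Y = mat (length H) (length F) (\<lambda>(p, q). hpart (H ! p) (F ! q) (v q $ p))"
  have cY: "Y \<in> carrier_mat (length H) (length F)" by (simp add: Y_def)
  have gY: "graded_map F H Y"
    by (rule graded_mapI) (auto simp: Y_def keys_hpart)
  have "D * Y = X"
  proof (rule eq_matI)
    fix r q assume "r < dim_row X" "q < dim_col X"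
    then have rq: "r < length G" "q < length F" using cX by auto
    have "(D * Y) $$ (r, q) = (\<Sum>p<length H. D $$ (r, p) * hpart (H ! p) (F ! q) (v q $ p))"
      unfolding index_mult_mat_sum[OF cD cY rq] using rq by (intro sum.cong) (auto simp: Y_def)
    also have "\<dots> = (\<Sum>p<length H. hpart (G ! r) (F ! q) (D $$ (r, p) * v q $ p))"
      using graded_mapD[OF D rq(1)] by (intro sum.cong refl mult_hpart) auto
    also have "\<dots> = hpart (G ! r) (F ! q) ((D *\<^sub>v v q) $ r)"
      using v[OF rq(2)] index_mult_vec_sum[OF cD _ rq(1), of "v q"] by (simp only: hpart_sum)
    also have "\<dots> = X $$ (r, q)"
      using v[OF rq(2)] hpart_self[OF graded_mapD[OF X rq]] rq cX by simp
    finally show "(D * Y) $$ (r, q) = X $$ (r, q)" .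
  qed (use cX cD cY in auto)
  then show ?thesis using gY that by blast
qed

section \<open>Exact graded complexes, comparison maps and homotopies\<close>

text \<open>No exactness is demanded at \<open>T\<close>: the image of \<open>d 0\<close> is the
  resolved module.\<close>

definition exact_complex ::
  "'v expo list \<Rightarrow> (nat \<Rightarrow> 'v expo list) \<Rightarrow> (nat \<Rightarrow> ('v, 'k::field) mpoly mat) \<Rightarrow> bool"
  where "exact_complex T F d \<longleftrightarrow> graded_map (F 0) T (d 0) \<and>
    (\<forall>i. graded_map (F (Suc i)) (F i) (d (Suc i))) \<and>
    (\<forall>i. mat_image (d (Suc i)) = mat_kernel (d i))"

lemma exact_complexD:
  assumes "exact_complex T F d"
  shows "graded_map (F 0) T (d 0)" "graded_map (F (Suc i)) (F i) (d (Suc i))"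
    "mat_image (d (Suc i)) = mat_kernel (d i)"
    "d 0 * d (Suc 0) = 0\<^sub>m (length T) (length (F (Suc 0)))"
    "d (Suc i) * d (Suc (Suc i)) = 0\<^sub>m (length (F i)) (length (F (Suc (Suc i))))"
proof -
  have 1: "graded_map (F 0) T (d 0)" "\<And>i. graded_map (F (Suc i)) (F i) (d (Suc i))"
    "\<And>i. mat_image (d (Suc i)) = mat_kernel (d i)"
    using assms unfolding exact_complex_def by blast+
  then show "graded_map (F 0) T (d 0)" "graded_map (F (Suc i)) (F i) (d (Suc i))"
    "mat_image (d (Suc i)) = mat_kernel (d i)"
    by auto
  note c = 1(1,2)[THEN graded_map_carrier]
  show "d 0 * d (Suc 0) = 0\<^sub>m (length T) (length (F (Suc 0)))"
    "d (Suc i) * d (Suc (Suc i)) = 0\<^sub>m (length (F i)) (length (F (Suc (Suc i))))"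
    using 1(3) mat_image_subset_kernel_iff[OF c(1) c(2)] mat_image_subset_kernel_iff[OF c(2) c(2)]
    by auto
qed

text \<open>The comparison theorem. The augmentation \<open>a\<close> of \<open>G\<close> is kept
  apart from \<open>e\<close>, so that it can be another augmentation of the same ideal or
  multiplication by a monomial after an augmentation.\<close>

lemma chain_map_lift:
  fixes d e :: "nat \<Rightarrow> ('v, 'k::field) mpoly mat"
  assumes d: "exact_complex T F d"
    and a: "graded_map (G 0) T a" "a * e (Suc 0) = 0\<^sub>m (length T) (length (G (Suc 0)))"
    and e: "\<And>i. graded_map (G (Suc i)) (G i) (e (Suc i))"
      "\<And>i. e (Suc i) * e (Suc (Suc i)) = 0\<^sub>m (length (G i)) (length (G (Suc (Suc i))))"
    and im: "mat_image a \<subseteq> mat_image (d 0)"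
  obtains \<phi> where "\<And>i. graded_map (G i) (F i) (\<phi> i)" "d 0 * \<phi> 0 = a"
    "\<And>i. d (Suc i) * \<phi> (Suc i) = \<phi> i * e (Suc i)"
proof -
  note D = exact_complexD[OF d]
  note cD = D(1,2)[THEN graded_map_carrier] and ce = e(1)[THEN graded_map_carrier]
  define tgt where "tgt i = (case i of 0 \<Rightarrow> T | Suc i \<Rightarrow> F i)" for i
  have gd: "graded_map (F i) (tgt i) (d i)" for i
    using D(1,2) by (cases i) (auto simp: tgt_def)
  note cd = gd[THEN graded_map_carrier]
  \<comment> \<open>The last conjunct says that \<open>f * e (Suc i)\<close> consists of cycles;
    exactness then lets it be lifted through \<open>d (Suc i)\<close>.\<close>
  let ?P = "\<lambda>i f. graded_map (G i) (F i) f \<and> (i = 0 \<longrightarrow> d 0 * f = a) \<and>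
    d i * (f * e (Suc i)) = 0\<^sub>m (length (tgt i)) (length (G (Suc i)))"
  have "\<exists>\<phi>. \<forall>i. ?P i (\<phi> i) \<and> d (Suc i) * \<phi> (Suc i) = \<phi> i * e (Suc i)"
  proof (rule dependent_nat_choice)
    obtain f where f: "graded_map (G 0) (F 0) f" "d 0 * f = a"
      using graded_lift[OF a(1) D(1) im] .
    moreover have "d 0 * (f * e (Suc 0)) = a * e (Suc 0)"
      using f(2) assoc_mult_mat[OF cD(1) graded_map_carrier[OF f(1)] ce] by simp
    ultimately show "\<exists>f. ?P 0 f"
      using a(2) by (auto simp: tgt_def)
  next
    fix f i assume f: "?P i f"
    then have g: "graded_map (G (Suc i)) (F i) (f * e (Suc i))"
      using e(1) graded_map_mult by blast
    have "mat_image (f * e (Suc i)) \<subseteq> mat_image (d (Suc i))"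
      using f mat_image_subset_kernel_iff[OF cd graded_map_carrier[OF g]] by (simp add: D(3))
    then obtain f' where f': "graded_map (G (Suc i)) (F (Suc i)) f'" "d (Suc i) * f' = f * e (Suc i)"
      using graded_lift[OF g D(2)] by blast
    have "d (Suc i) * (f' * e (Suc (Suc i))) = d (Suc i) * f' * e (Suc (Suc i))"
      using assoc_mult_mat[OF cD(2) graded_map_carrier[OF f'(1)] ce] by simp
    also have "\<dots> = f * (e (Suc i) * e (Suc (Suc i)))"
      unfolding f'(2) using f by (intro assoc_mult_mat[OF graded_map_carrier ce ce]) auto
    also have "\<dots> = 0\<^sub>m (length (F i)) (length (G (Suc (Suc i))))"
      using f graded_map_carrier[of "G i" "F i" f] by (simp add: e(2))
    finally show "\<exists>f'. ?P (Suc i) f' \<and> d (Suc i) * f' = f * e (Suc i)"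
      using f' by (auto simp: tgt_def)
  qed
  then show ?thesis using that by metis
qed

text \<open>Since \<open>d 0 * \<psi> 0\<close> vanishes, \<open>\<psi> 0\<close> factors through
  \<open>d (Suc 0)\<close>; each correction \<open>\<psi> (Suc i) - h i * d (Suc i)\<close> is again
  a cycle and can be lifted. It is meant for the difference between a composite of comparison maps
  and the identity.\<close>

lemma null_homotopy:
  fixes d \<psi> :: "nat \<Rightarrow> ('v, 'k::field) mpoly mat"
  assumes d: "exact_complex T F d"
    and \<psi>: "\<And>i. graded_map (F i) (F i) (\<psi> i)" "d 0 * \<psi> 0 = 0\<^sub>m (length T) (length (F 0))"
      "\<And>i. d (Suc i) * \<psi> (Suc i) = \<psi> i * d (Suc i)"
  obtains h where "\<And>i. graded_map (F i) (F (Suc i)) (h i)" "d (Suc 0) * h 0 = \<psi> 0"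
    "\<And>i. d (Suc (Suc i)) * h (Suc i) = \<psi> (Suc i) - h i * d (Suc i)"
proof -
  note D = exact_complexD[OF d]
  note cD = D(1,2)[THEN graded_map_carrier] and c\<psi> = \<psi>(1)[THEN graded_map_carrier]
  \<comment> \<open>The last conjunct is exactly what makes \<open>d (Suc i)\<close> annihilate the
    correction \<open>\<psi> (Suc i) - f * d (Suc i)\<close>.\<close>
  let ?P = "\<lambda>i f. graded_map (F i) (F (Suc i)) f \<and> (i = 0 \<longrightarrow> d (Suc 0) * f = \<psi> 0) \<and>
    d (Suc i) * (f * d (Suc i)) = \<psi> i * d (Suc i)"
  have "\<exists>h. \<forall>i. ?P i (h i) \<and> d (Suc (Suc i)) * h (Suc i) = \<psi> (Suc i) - h i * d (Suc i)"
  proof (rule dependent_nat_choice)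
    have "mat_image (\<psi> 0) \<subseteq> mat_image (d (Suc 0))"
      using mat_image_subset_kernel_iff[OF cD(1) c\<psi>] \<psi>(2) D(3) by auto
    then obtain f where f: "graded_map (F 0) (F (Suc 0)) f" "d (Suc 0) * f = \<psi> 0"
      using graded_lift[OF \<psi>(1) D(2)] by blast
    moreover have "d (Suc 0) * (f * d (Suc 0)) = \<psi> 0 * d (Suc 0)"
      using f(2) assoc_mult_mat[OF cD(2) graded_map_carrier[OF f(1)] cD(2)] by simp
    ultimately show "\<exists>f. ?P 0 f" by auto
  next
    fix f i assume f: "?P i f"
    then have cf: "f \<in> carrier_mat (length (F (Suc i))) (length (F i))"
      using graded_map_carrier by blast
    have cfd: "f * d (Suc i) \<in> carrier_mat (length (F (Suc i))) (length (F (Suc i)))"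
      using cf cD(2) by (rule mult_carrier_mat)
    let ?X = "\<psi> (Suc i) - f * d (Suc i)"
    have g: "graded_map (F (Suc i)) (F (Suc i)) ?X"
      using f by (intro graded_map_minus graded_map_mult[OF _ D(2)] \<psi>(1)) auto
    have "d (Suc i) * ?X = d (Suc i) * \<psi> (Suc i) - d (Suc i) * (f * d (Suc i))"
      by (rule mult_minus_distrib_mat[OF cD(2) c\<psi> cfd])
    also have "\<dots> = 0\<^sub>m (length (F i)) (length (F (Suc i)))"
      using f \<psi>(3) mult_carrier_mat[OF c\<psi> cD(2)] by (simp add: minus_r_inv_mat)
    finally have "mat_image ?X \<subseteq> mat_image (d (Suc (Suc i)))"
      using mat_image_subset_kernel_iff[OF cD(2) graded_map_carrier[OF g]] D(3) by auto
    then obtain f' where f': "graded_map (F (Suc i)) (F (Suc (Suc i))) f'" "d (Suc (Suc i)) * f' = ?X"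
      using graded_lift[OF g D(2)] by blast
    note cf' = graded_map_carrier[OF f'(1)]
    have "d (Suc (Suc i)) * (f' * d (Suc (Suc i))) = ?X * d (Suc (Suc i))"
      using f'(2) assoc_mult_mat[OF cD(2) cf' cD(2)] by simp
    also have "\<dots> = \<psi> (Suc i) * d (Suc (Suc i)) - f * d (Suc i) * d (Suc (Suc i))"
      by (rule minus_mult_distrib_mat[OF c\<psi> cfd cD(2)])
    also have "f * d (Suc i) * d (Suc (Suc i)) = f * (d (Suc i) * d (Suc (Suc i)))"
      by (rule assoc_mult_mat[OF cf cD(2) cD(2)])
    also have "\<dots> = 0\<^sub>m (length (F (Suc i))) (length (F (Suc (Suc i))))"
      using cf by (simp add: D(5))
    also have "\<psi> (Suc i) * d (Suc (Suc i)) - \<dots> = \<psi> (Suc i) * d (Suc (Suc i))"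
      using c\<psi>[of "Suc i"] cD(2)[of "Suc i"] by (intro eq_matI) auto
    finally show "\<exists>f'. ?P (Suc i) f' \<and> d (Suc (Suc i)) * f' = ?X"
      using f' by auto
  qed
  then show ?thesis using that by metis
qed

section \<open>Uniqueness of the degrees of a minimal resolution\<close>

lemma elements_mat_subset_iff:
  "elements_mat (A :: ('v, 'k::field) mpoly mat) \<subseteq> ideal_gen (range Var) \<longleftrightarrow>
    (\<forall>p < dim_row A. \<forall>q < dim_col A. lookup (A $$ (p, q)) 0 = 0)"
proof -
  have "x \<in> elements_mat A \<longleftrightarrow> (\<exists>p < dim_row A. \<exists>q < dim_col A. x = A $$ (p, q))" for x
    by (force simp: elements_mat_def)
  then show ?thesis
    by (auto simp: ideal_gen_range_Var subset_iff)
qed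

lemma min_graded_free_resolution_iff:
  "min_graded_free_resolution F d J \<longleftrightarrow> exact_complex [0] F d \<and> (\<lambda>v. v $ 0) ` mat_image (d 0) = J \<and>
    (\<forall>i. \<forall>p < length (F i). \<forall>q < length (F (Suc i)). lookup (d (Suc i) $$ (p, q)) 0 = 0)"
  (is "?L \<longleftrightarrow> ?R")
proof -
  have "dim_row (d (Suc i)) = length (F i) \<and> dim_col (d (Suc i)) = length (F (Suc i))"
    if "\<forall>i. graded_map (F (Suc i)) (F i) (d (Suc i))" for i
    using that graded_map_carrier by blast
  then show ?thesis
    unfolding min_graded_free_resolution_def exact_complex_def elements_mat_subset_iff by auto
qed

text \<open>A vector of length one is its entry, so \<open>J\<close> determines the image. Two
  resolutions of \<open>J\<close> thus have augmentations with equal image, as comparison maps in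
  both directions require.\<close>

lemma mat_image_augmentation:
  assumes "A \<in> carrier_mat 1 n" "(\<lambda>v. v $ 0) ` mat_image A = J"
  shows "mat_image A = {v \<in> carrier_vec 1. v $ 0 \<in> J}"
proof (intro equalityI subsetI)
  show "v \<in> {v \<in> carrier_vec 1. v $ 0 \<in> J}" if "v \<in> mat_image A" for v
    using that assms by (auto simp: mat_image_def)
  fix v assume v: "v \<in> {v \<in> carrier_vec 1. v $ 0 \<in> J}"
  then obtain w where w: "w \<in> mat_image A" "v $ 0 = w $ 0"
    using assms(2) by auto
  then have "dim_vec w = 1" using assms(1) by (auto simp: mat_image_def)
  then have "v = w" using v w by (intro eq_vecI) auto
  then show "v \<in> mat_image A" using w by simp
qed

lemma lookup_mult_mat_0:
  fixes A B :: "('v, 'k::field) mpoly mat"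
  assumes "A \<in> carrier_mat l m" "B \<in> carrier_mat m n" "i < l" "j < n"
  shows "lookup ((A * B) $$ (i, j)) 0 = (\<Sum>p<m. lookup (A $$ (i, p)) 0 * lookup (B $$ (p, j)) 0)"
  unfolding index_mult_mat_sum[OF assms] by (simp add: lookup_sum lookup_mult_0)

text \<open>The composite of comparison maps \<open>F \<rightarrow> F' \<rightarrow> F\<close> is homotopic to the identity, so by minimality
  it has constant coefficients 1 on the diagonal.\<close>

theorem min_graded_free_resolution_degrees_subset:
  fixes J :: "('v, 'k::field) mpoly set"
  assumes m: "min_graded_free_resolution F d J" and m': "min_graded_free_resolution F' d' J"
  shows "set (F k) \<subseteq> set (F' k)"
proof -
  have d: "exact_complex [0] F d" and d': "exact_complex [0] F' d'"
    using m m' by (auto simp: min_graded_free_resolution_iff)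
  note D = exact_complexD[OF d] and D' = exact_complexD[OF d']
  note cD = D(1,2)[THEN graded_map_carrier]
  note cD' = D'(1,2)[THEN graded_map_carrier]
  have im: "mat_image (d 0) = mat_image (d' 0)"
    using m m' mat_image_augmentation[of "d 0"] mat_image_augmentation[of "d' 0"] cD(1) cD'(1)
    by (auto simp: min_graded_free_resolution_iff)
  obtain \<alpha> where \<alpha>: "\<And>i. graded_map (F i) (F' i) (\<alpha> i)" "d' 0 * \<alpha> 0 = d 0"
    "\<And>i. d' (Suc i) * \<alpha> (Suc i) = \<alpha> i * d (Suc i)"
    using chain_map_lift[where e = d and G = F, OF d' D(1,4,2,5)] im by auto
  obtain \<beta> where \<beta>: "\<And>i. graded_map (F' i) (F i) (\<beta> i)" "d 0 * \<beta> 0 = d' 0"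
    "\<And>i. d (Suc i) * \<beta> (Suc i) = \<beta> i * d' (Suc i)"
    using chain_map_lift[where e = d' and G = F', OF d D'(1,4,2,5)] im by auto
  note c\<alpha> = \<alpha>(1)[THEN graded_map_carrier] and c\<beta> = \<beta>(1)[THEN graded_map_carrier]
  note c\<beta>\<alpha> = mult_carrier_mat[OF c\<beta> c\<alpha>]
  define \<psi> where "\<psi> i = \<beta> i * \<alpha> i - 1\<^sub>m (length (F i))" for i
  have 1: "graded_map (F i) (F i) (\<psi> i)" for i
    unfolding \<psi>_def by (intro graded_map_minus graded_map_mult[OF \<beta>(1) \<alpha>(1)] graded_map_one)
  have "d 0 * (\<beta> 0 * \<alpha> 0) = d 0"
    using assoc_mult_mat[OF cD(1) c\<beta> c\<alpha>] \<beta>(2) \<alpha>(2) by simp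
  then have 2: "d 0 * \<psi> 0 = 0\<^sub>m (length [0]) (length (F 0))"
    unfolding \<psi>_def mult_minus_distrib_mat[OF cD(1) c\<beta>\<alpha> one_carrier_mat]
    using cD(1) by (simp add: minus_r_inv_mat)
  have 3: "d (Suc i) * \<psi> (Suc i) = \<psi> i * d (Suc i)" for i
  proof -
    have "d (Suc i) * (\<beta> (Suc i) * \<alpha> (Suc i)) = \<beta> i * d' (Suc i) * \<alpha> (Suc i)"
      using assoc_mult_mat[OF cD(2) c\<beta> c\<alpha>] \<beta>(3) by metis
    also have "\<dots> = \<beta> i * (\<alpha> i * d (Suc i))"
      using assoc_mult_mat[OF c\<beta> cD'(2) c\<alpha>] \<alpha>(3) by metis
    also have "\<dots> = \<beta> i * \<alpha> i * d (Suc i)"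
      using assoc_mult_mat[OF c\<beta> c\<alpha> cD(2)] by metis
    finally show ?thesis
      unfolding \<psi>_def mult_minus_distrib_mat[OF cD(2) c\<beta>\<alpha> one_carrier_mat]
        minus_mult_distrib_mat[OF c\<beta>\<alpha> one_carrier_mat cD(2)]
      using cD(2)[of i] by simp
  qed
  obtain h where h: "\<And>i. graded_map (F i) (F (Suc i)) (h i)" "d (Suc 0) * h 0 = \<psi> 0"
    "\<And>i. d (Suc (Suc i)) * h (Suc i) = \<psi> (Suc i) - h i * d (Suc i)"
    using null_homotopy[OF d 1 2 3] by blast
  note ch = h(1)[THEN graded_map_carrier]
  have min: "lookup (d (Suc i) $$ (p, q)) 0 = 0" if "p < length (F i)" "q < length (F (Suc i))"
      for i p q
    using m that by (simp add: min_graded_free_resolution_iff)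
  \<comment> \<open>Both terms of the homotopy formula have a differential as a factor, whose
    entries have no constant term.\<close>
  have dh: "lookup ((d (Suc i) * h i) $$ (q, q)) 0 = 0" if "q < length (F i)" for i q
    using that min by (simp add: lookup_mult_mat_0[OF cD(2) ch])
  have \<psi>0: "lookup (\<psi> k $$ (q, q)) 0 = 0" if q: "q < length (F k)" for q
  proof (cases k)
    case 0
    then show ?thesis using dh[of q 0] h(2) q by simp
  next
    case (Suc i)
    have "lookup ((h i * d (Suc i)) $$ (q, q)) 0 = 0"
      using q Suc min by (simp add: lookup_mult_mat_0[OF ch cD(2)])
    moreover have "\<psi> k $$ (q, q) = (d (Suc k) * h k) $$ (q, q) + (h i * d (Suc i)) $$ (q, q)"
      using h(3)[of i] q Suc graded_map_carrier[OF 1[of k]] ch[of i] cD(2)[of i] by simp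
    ultimately show ?thesis
      using dh[OF q] by (simp add: lookup_add)
  qed
  show ?thesis
  proof
    fix b assume "b \<in> set (F k)"
    then obtain q where q: "q < length (F k)" "b = F k ! q"
      by (auto simp: in_set_conv_nth)
    have "lookup ((\<beta> k * \<alpha> k) $$ (q, q)) 0 = 1"
      using \<psi>0[OF q(1)] q(1) c\<beta>\<alpha>[of k] by (simp add: \<psi>_def lookup_minus)
    then have "(\<Sum>p<length (F' k). lookup (\<beta> k $$ (q, p)) 0 * lookup (\<alpha> k $$ (p, q)) 0) \<noteq> 0"
      by (simp add: lookup_mult_mat_0[OF c\<beta> c\<alpha> q(1) q(1)])
    then obtain p where "p \<in> {..<length (F' k)}"
      "lookup (\<beta> k $$ (q, p)) 0 * lookup (\<alpha> k $$ (p, q)) 0 \<noteq> 0"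
      by (rule sum.not_neutral_contains_not_neutral)
    then have p: "p < length (F' k)" "lookup (\<alpha> k $$ (p, q)) 0 \<noteq> 0"
      by auto
    \<comment> \<open>A nonzero constant term in a homogeneous entry forces its row and its column
      to have the same degree.\<close>
    then have "0 \<in> keys (\<alpha> k $$ (p, q))"
      by (simp add: in_keys_iff)
    then have "F' k ! p = b"
      using graded_mapD[OF \<alpha>(1) p(1) q(1)] q(2) by force
    then show "b \<in> set (F' k)" using p(1) by auto
  qed
qed

section \<open>Mapping cones\<close>

lemma graded_map_shift:
  assumes "graded_map F G A"
  shows "graded_map (map ((+) u) F) (map ((+) u) G) A"
  using assms by (auto simp: graded_map_def add.assoc)

text \<open>The sign of \<open>C\<close> is the one that makes consecutive blocks of a mapping cone
  compose to zero. The lower row may be absent (\<open>S = []\<close>), which covers the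
  augmentation.\<close>

lemma graded_map_block:
  assumes A: "graded_map F T A" and B: "graded_map K T B" and C: "graded_map K S C"
  shows "graded_map (F @ K) (T @ S) (four_block_mat A B (0\<^sub>m (length S) (length F)) (- C))"
proof (rule graded_mapI)
  note c = A[THEN graded_map_carrier] B[THEN graded_map_carrier] C[THEN graded_map_carrier]
  then show "four_block_mat A B (0\<^sub>m (length S) (length F)) (- C)
      \<in> carrier_mat (length (T @ S)) (length (F @ K))"
    by simp
  fix p q m assume pq: "p < length (T @ S)" "q < length (F @ K)"
    and m: "m \<in> keys (four_block_mat A B (0\<^sub>m (length S) (length F)) (- C) $$ (p, q))"
  show "(T @ S) ! p + m = (F @ K) ! q"
  proof (cases "p < length T"; cases "q < length F")
    assume "p < length T" "q < length F"
    then show ?thesis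
      using m c pq graded_mapD[OF A, of p q] by (auto simp: nth_append)
  next
    assume "p < length T" "\<not> q < length F"
    then show ?thesis
      using m c pq graded_mapD[OF B, of p "q - length F"] by (auto simp: nth_append)
  next
    assume "\<not> p < length T" "q < length F"
    then show ?thesis
      using m c pq by (auto simp: nth_append)
  next
    assume "\<not> p < length T" "\<not> q < length F"
    then show ?thesis
      using m c pq graded_mapD[OF C, of "p - length T" "q - length F"]
      by (auto simp: nth_append in_keys_iff)
  qed
qed

lemma mult_mat_vec_uminus:
  fixes A :: "'a::comm_ring_1 mat"
  assumes "A \<in> carrier_mat l m" "v \<in> carrier_vec m"
  shows "A *\<^sub>v (- v) = - (A *\<^sub>v v)"
  using assms by (intro eq_vecI) auto

lemma block_mult_vec:
  fixes A B C :: "'a::comm_ring_1 mat"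
  assumes c: "A \<in> carrier_mat t f" "B \<in> carrier_mat t k" "C \<in> carrier_mat s k"
    and v: "a \<in> carrier_vec f" "g \<in> carrier_vec k"
  shows "four_block_mat A B (0\<^sub>m s f) (- C) *\<^sub>v (a @\<^sub>v g) = (A *\<^sub>v a + B *\<^sub>v g) @\<^sub>v - (C *\<^sub>v g)"
proof -
  have "0\<^sub>m s f *\<^sub>v a + - C *\<^sub>v g = - (C *\<^sub>v g)"
    using c v by (intro eq_vecI) auto
  then show ?thesis
    using four_block_mat_mult_vec[OF c(1,2) zero_carrier_mat uminus_carrier_mat[OF c(3)] v] by simp
qed

text \<open>A diagram chase. The hypothesis \<open>ker\<close> is a weak form of exactness of the
  second complex, chosen to fit the bottom of the cone as well: there \<open>C\<close> has no rows,
  \<open>B\<close> is multiplication by a monomial, and it is the colon ideal that puts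
  \<open>g\<close> into the image of \<open>C'\<close>.\<close>

lemma cone_exact:
  fixes A B C A' B' C' :: "'a::comm_ring_1 mat"
  assumes c: "A \<in> carrier_mat t f" "B \<in> carrier_mat t k" "C \<in> carrier_mat s k"
    and c': "A' \<in> carrier_mat f f'" "B' \<in> carrier_mat f k'" "C' \<in> carrier_mat k k'"
    and A: "mat_image A' = mat_kernel A" and AB: "A * B' = B * C'" and CC: "C * C' = 0\<^sub>m s k'"
    and ker: "\<And>a g. a \<in> carrier_vec f \<Longrightarrow> g \<in> carrier_vec k \<Longrightarrow> A *\<^sub>v a + B *\<^sub>v g = 0\<^sub>v t \<Longrightarrow>
      C *\<^sub>v g = 0\<^sub>v s \<Longrightarrow> g \<in> mat_image C'"
  shows "mat_image (four_block_mat A' B' (0\<^sub>m k f') (- C')) =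
    mat_kernel (four_block_mat A B (0\<^sub>m s f) (- C))" (is "mat_image ?B2 = mat_kernel ?B1")
proof (intro equalityI subsetI)
  have cB1: "?B1 \<in> carrier_mat (t + s) (f + k)" and cB2: "?B2 \<in> carrier_mat (f + k) (f' + k')"
    using c c' by simp_all
  have AA: "A * A' = 0\<^sub>m t f'"
    using mat_image_subset_kernel_iff[OF c(1) c'(1)] A by simp
  have AB': "A *\<^sub>v (B' *\<^sub>v g) = B *\<^sub>v (C' *\<^sub>v g)" if "g \<in> carrier_vec k'" for g
    using AB assoc_mult_mat_vec[OF c(1) c'(2) that] assoc_mult_mat_vec[OF c(2) c'(3) that] by simp
  {
    fix v assume "v \<in> mat_image ?B2"
    then obtain w where w: "w \<in> carrier_vec (f' + k')" "v = ?B2 *\<^sub>v w"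
      using cB2 by (auto simp: mat_image_def)
    define a g where "a = vec_first w f'" and "g = vec_last w k'"
    then have ag: "a \<in> carrier_vec f'" "g \<in> carrier_vec k'" and wag: "w = a @\<^sub>v g"
      using w by simp_all
    have v: "v = (A' *\<^sub>v a + B' *\<^sub>v g) @\<^sub>v - (C' *\<^sub>v g)"
      unfolding w(2) wag by (rule block_mult_vec[OF c' ag])
    have car: "A' *\<^sub>v a + B' *\<^sub>v g \<in> carrier_vec f" "- (C' *\<^sub>v g) \<in> carrier_vec k"
      "B *\<^sub>v (C' *\<^sub>v g) \<in> carrier_vec t"
      using c c' ag by auto
    have "A *\<^sub>v (A' *\<^sub>v a + B' *\<^sub>v g) = A *\<^sub>v (A' *\<^sub>v a) + B *\<^sub>v (C' *\<^sub>v g)"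
      using mult_add_distrib_mat_vec[OF c(1), of "A' *\<^sub>v a" "B' *\<^sub>v g"] c' ag by (simp add: AB')
    also have "A *\<^sub>v (A' *\<^sub>v a) = 0\<^sub>m t f' *\<^sub>v a"
      using assoc_mult_mat_vec[OF c(1) c'(1) ag(1)] AA by simp
    also have "\<dots> = 0\<^sub>v t"
      using ag by (intro eq_vecI) auto
    finally have 1: "A *\<^sub>v (A' *\<^sub>v a + B' *\<^sub>v g) + B *\<^sub>v - (C' *\<^sub>v g) = 0\<^sub>v t"
      using car(3) c c' ag by (simp add: mult_mat_vec_uminus[OF c(2)])
    have "C *\<^sub>v - (C' *\<^sub>v g) = - (0\<^sub>m s k' *\<^sub>v g)"
      using assoc_mult_mat_vec[OF c(3) c'(3) ag(2)] CC c' ag by (simp add: mult_mat_vec_uminus[OF c(3)])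
    also have "- \<dots> = 0\<^sub>v s"
      using ag by (intro eq_vecI) auto
    finally have "?B1 *\<^sub>v v = 0\<^sub>v t @\<^sub>v 0\<^sub>v s"
      unfolding v block_mult_vec[OF c car(1,2)] 1 by simp
    then show "v \<in> mat_kernel ?B1"
      using v car by (intro mat_kernelI[OF cB1]) auto
  }
  {
    fix v assume "v \<in> mat_kernel ?B1"
    then have w: "v \<in> carrier_vec (f + k)" "?B1 *\<^sub>v v = 0\<^sub>v (t + s)"
      using mat_kernelD[OF cB1] by blast+
    define a g where "a = vec_first v f" and "g = vec_last v k"
    then have ag: "a \<in> carrier_vec f" "g \<in> carrier_vec k" and vag: "v = a @\<^sub>v g"
      using w by simp_all
    have "0\<^sub>v (t + s) = 0\<^sub>v t @\<^sub>v 0\<^sub>v s"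
      by (intro eq_vecI) auto
    then have "(A *\<^sub>v a + B *\<^sub>v g) @\<^sub>v - (C *\<^sub>v g) = 0\<^sub>v t @\<^sub>v 0\<^sub>v s"
      using w(2) block_mult_vec[OF c ag] vag by simp
    then have 0: "A *\<^sub>v a + B *\<^sub>v g = 0\<^sub>v t" "- (C *\<^sub>v g) = 0\<^sub>v s"
      using append_vec_eq[of "A *\<^sub>v a + B *\<^sub>v g" t "0\<^sub>v t"] c ag by auto
    then have "C *\<^sub>v g = 0\<^sub>v s"
      using c ag by (simp add: uminus_zero_vec_eq[of _ s])
    then obtain h where h: "h \<in> carrier_vec k'" "g = C' *\<^sub>v h"
      using ker[OF ag 0(1)] c' by (auto simp: mat_image_def)
    \<comment> \<open>\<open>B' *\<^sub>v h\<close> compensates for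
      \<open>g = C' *\<^sub>v h\<close>: as \<open>A * B' = B * C'\<close>, the vector
      \<open>a + B' *\<^sub>v h\<close> lies in the kernel of \<open>A\<close>. The preimage sought
      is \<open>b @\<^sub>v - h\<close>.\<close>
    have Bh: "B' *\<^sub>v h \<in> carrier_vec f" using c' h by auto
    have "A *\<^sub>v (a + B' *\<^sub>v h) = 0\<^sub>v t"
      using mult_add_distrib_mat_vec[OF c(1) ag(1) Bh] AB'[OF h(1)] h(2) 0(1) by simp
    then have "a + B' *\<^sub>v h \<in> mat_image A'"
      unfolding A using ag Bh by (intro mat_kernelI[OF c(1)]) auto
    then obtain b where b: "b \<in> carrier_vec f'" "a + B' *\<^sub>v h = A' *\<^sub>v b"
      using c' by (auto simp: mat_image_def)
    have "a = A' *\<^sub>v b + B' *\<^sub>v - h"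
      using b(2)[symmetric] ag Bh by (simp add: mult_mat_vec_uminus[OF c'(2) h(1)])
    moreover have "g = - (C' *\<^sub>v - h)"
      using h c' by (simp add: mult_mat_vec_uminus[OF c'(3)])
    ultimately have "v = ?B2 *\<^sub>v (b @\<^sub>v - h)"
      using block_mult_vec[OF c' b(1), of "- h"] h(1) vag by simp
    moreover have "b @\<^sub>v - h \<in> carrier_vec (dim_col ?B2)"
      using b h c' by simp
    ultimately show "v \<in> mat_image ?B2"
      by (auto simp: mat_image_def)
  }
qed

text \<open>If \<open>F\<close> and \<open>G\<close> resolve \<open>I\<close> and \<open>I : x\<^sup>u\<close>, the cone of a lift \<open>G(-u) \<rightarrow> F\<close> of multiplication
  by \<open>x\<^sup>u\<close> resolves \<open>I + (x\<^sup>u)\<close>. It is minimal because the two modules in each homological degree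
  of the lift share no degree.\<close>

lemma min_graded_free_resolution_cone:
  fixes I Q :: "('v, 'k::field) mpoly set"
  assumes F: "min_graded_free_resolution F d I" and G: "min_graded_free_resolution G e Q"
    and Q: "ideal_colon I (xpow u) = Q"
    and disj: "\<And>k. (+) u ` set (G k) \<inter> set (F k) = {}" and G0: "0 \<notin> set (G 0)"
  obtains D where "min_graded_free_resolution
    (\<lambda>k. F k @ (case k of 0 \<Rightarrow> [u] | Suc i \<Rightarrow> map ((+) u) (G i))) D {f + g * xpow u |f g. f \<in> I}"
proof -
  have exF: "exact_complex [0] F d" and exG: "exact_complex [0] G e"
    and imF: "(\<lambda>v. v $ 0) ` mat_image (d 0) = I" and imG: "(\<lambda>v. v $ 0) ` mat_image (e 0) = Q"
    and minF: "\<And>i p q. p < length (F i) \<Longrightarrow> q < length (F (Suc i)) \<Longrightarrow> lookup (d (Suc i) $$ (p, q)) 0 = 0"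
    and minG: "\<And>i p q. p < length (G i) \<Longrightarrow> q < length (G (Suc i)) \<Longrightarrow> lookup (e (Suc i) $$ (p, q)) 0 = 0"
    using F G by (auto simp: min_graded_free_resolution_iff)
  note dF = exact_complexD[OF exF] and dG = exact_complexD[OF exG]
  note cF = dF(1,2)[THEN graded_map_carrier] and cG = dG(1,2)[THEN graded_map_carrier]
  define U :: "('v, 'k) mpoly mat" where "U = mat 1 1 (\<lambda>_. xpow u)"
  have gU: "graded_map (map ((+) u) [0]) [0] U"
    by (rule graded_mapI) (auto simp: U_def xpow_def)
  note cU = graded_map_carrier[OF gU]
  have Uv: "U *\<^sub>v v = xpow u \<cdot>\<^sub>v v" if "v \<in> carrier_vec 1" for v
    using that by (intro eq_vecI) (auto simp: U_def scalar_prod_def)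
  let ?G = "\<lambda>i. map ((+) u) (G i)"
  have ce0: "e 0 \<in> carrier_mat 1 (length (G 0))" using cG(1) by simp
  have cU1: "U \<in> carrier_mat 1 1" using cU by simp
  have imd: "mat_image (d 0) = {v \<in> carrier_vec 1. v $ 0 \<in> I}"
    using cF(1) imF by (intro mat_image_augmentation) auto
  have ime: "mat_image (e 0) = {v \<in> carrier_vec 1. v $ 0 \<in> Q}"
    using cG(1) imG by (intro mat_image_augmentation) auto
  have im: "mat_image (U * e 0) \<subseteq> mat_image (d 0)"
  proof
    fix v assume "v \<in> mat_image (U * e 0)"
    then obtain w where w: "w \<in> carrier_vec (length (G 0))" "v = (U * e 0) *\<^sub>v w"
      using cG(1) by (auto simp: mat_image_def)
    then have "v = xpow u \<cdot>\<^sub>v (e 0 *\<^sub>v w)"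
      using assoc_mult_mat_vec[OF cU1 ce0 w(1)] Uv[of "e 0 *\<^sub>v w"] ce0 by simp
    moreover have "e 0 *\<^sub>v w \<in> mat_image (e 0)"
      using w(1) ce0 by (auto simp: mat_image_def)
    ultimately show "v \<in> mat_image (d 0)"
      unfolding imd ime using Q ce0 by (auto simp: ideal_colon_def mult.commute)
  qed
  have "U * e 0 * e (Suc 0) = 0\<^sub>m (length [0]) (length (?G (Suc 0)))"
    using assoc_mult_mat[OF cU1 ce0 cG(2)] dG(4) cU1 by simp
  then obtain \<phi> where \<phi>: "\<And>i. graded_map (?G i) (F i) (\<phi> i)" "d 0 * \<phi> 0 = U * e 0"
    "\<And>i. d (Suc i) * \<phi> (Suc i) = \<phi> i * e (Suc i)"
    using chain_map_lift[OF exF, where a = "U * e 0" and G = ?G and e = e]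
      graded_map_mult[OF gU graded_map_shift[OF dG(1)]] graded_map_shift[OF dG(2)] dG(5) im
    by auto
  have c\<phi>: "\<phi> i \<in> carrier_mat (length (F i)) (length (G i))" for i
    using graded_map_carrier[OF \<phi>(1)] by simp
  have \<phi>0: "lookup (\<phi> i $$ (p, q)) 0 = 0" if "p < length (F i)" "q < length (G i)" for i p q
  proof (rule ccontr)
    assume "lookup (\<phi> i $$ (p, q)) 0 \<noteq> 0"
    then have "0 \<in> keys (\<phi> i $$ (p, q))" by (simp add: in_keys_iff)
    then have "F i ! p = u + G i ! q"
      using graded_mapD[OF \<phi>(1), of p i q] that by force
    then show False
      using disj[of i] that nth_mem[OF that(1)] nth_mem[OF that(2)] by force
  qed
  \<comment> \<open>In the cone \<open>e 0\<close> is part of a differential and no longer an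
    augmentation, so it has to meet the minimality condition from which it was exempt;
    \<open>G0\<close> gives this by degrees.\<close>
  have e0: "lookup (e 0 $$ (p, q)) 0 = 0" if "p < 1" "q < length (G 0)" for p q
  proof (rule ccontr)
    assume "lookup (e 0 $$ (p, q)) 0 \<noteq> 0"
    then have "0 \<in> keys (e 0 $$ (p, q))" by (simp add: in_keys_iff)
    then have "G 0 ! q = 0"
      using graded_mapD[OF dG(1), of p q] that by force
    then show False
      using G0 that nth_mem by metis
  qed
  \<comment> \<open>The cone has \<open>G (k - 1)\<close> shifted by \<open>u\<close> in homological
    degree \<open>k\<close>; at 0 its place is taken by a free module on one generator of degree
    \<open>u\<close>.\<close>
  let ?K = "\<lambda>k. case k of 0 \<Rightarrow> [u] | Suc i \<Rightarrow> ?G i"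
  let ?H = "\<lambda>k. F k @ ?K k"
  \<comment> \<open>The augmentation is padded with blocks without rows to give it the form that
    \<open>cone_exact\<close> treats.\<close>
  define D where "D k = (case k of
      0 \<Rightarrow> four_block_mat (d 0) U (0\<^sub>m 0 (length (F 0))) (- 0\<^sub>m 0 1)
    | Suc i \<Rightarrow> four_block_mat (d (Suc i)) (\<phi> i) (0\<^sub>m (length (?K i)) (length (F (Suc i)))) (- e i))"
        for k
  have g0: "graded_map (?H 0) [0] (D 0)"
    using graded_map_block[OF dF(1), of "[u]" U "[]" "0\<^sub>m 0 1"] gU
    by (simp add: D_def graded_map_def)
  have gK: "graded_map (?G i) (?K i) (e i)" for i
    using graded_map_shift[OF dG(1)] graded_map_shift[OF dG(2)] by (cases i) auto
  have gS: "graded_map (?H (Suc i)) (?H i) (D (Suc i))" for i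
    using graded_map_block[OF dF(2) \<phi>(1) gK] by (simp add: D_def)
  have ex0: "mat_image (D (Suc 0)) = mat_kernel (D 0)"
  proof -
    have "mat_image (four_block_mat (d (Suc 0)) (\<phi> 0) (0\<^sub>m 1 (length (F (Suc 0)))) (- e 0)) =
        mat_kernel (four_block_mat (d 0) U (0\<^sub>m 0 (length (F 0))) (- 0\<^sub>m 0 1))"
    proof (rule cone_exact[where t = 1 and k = 1 and s = 0])
      fix a g :: "('v, 'k) mpoly vec"
      assume a: "a \<in> carrier_vec (length (F 0))" and g: "g \<in> carrier_vec 1"
        and *: "d 0 *\<^sub>v a + U *\<^sub>v g = 0\<^sub>v 1"
      have "d 0 *\<^sub>v - a = xpow u \<cdot>\<^sub>v g"
      proof (intro eq_vecI)
        fix i assume i: "i < dim_vec (xpow u \<cdot>\<^sub>v g)"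
        have "(d 0 *\<^sub>v a + U *\<^sub>v g) $ i = 0" using * i g by simp
        then show "(d 0 *\<^sub>v - a) $ i = (xpow u \<cdot>\<^sub>v g) $ i"
          using i g cF(1) a by (simp add: mult_mat_vec_uminus[OF cF(1)] Uv neg_eq_iff_add_eq_0)
      qed (use cF(1) g in auto)
      moreover have "d 0 *\<^sub>v - a \<in> mat_image (d 0)"
        using a cF(1) by (intro mat_imageI) auto
      ultimately have "g $ 0 \<in> Q"
        using g Q imd by (auto simp: ideal_colon_def mult.commute)
      then show "g \<in> mat_image (e 0)"
        using g ime by simp
    qed (use cF cU1 c\<phi> ce0 dF(3) \<phi>(2) in auto)
    then show ?thesis
      by (simp add: D_def)
  qed
  have exS: "mat_image (D (Suc (Suc i))) = mat_kernel (D (Suc i))" for i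
  proof -
    have ci: "e i \<in> carrier_mat (length (?K i)) (length (G i))"
      using graded_map_carrier[OF gK] by simp
    have "mat_image (four_block_mat (d (Suc (Suc i))) (\<phi> (Suc i))
          (0\<^sub>m (length (G i)) (length (F (Suc (Suc i))))) (- e (Suc i))) =
        mat_kernel (four_block_mat (d (Suc i)) (\<phi> i) (0\<^sub>m (length (?K i)) (length (F (Suc i)))) (- e i))"
    proof (rule cone_exact[OF cF(2) c\<phi> ci cF(2) c\<phi> cG(2) dF(3) \<phi>(3)])
      show "e i * e (Suc i) = 0\<^sub>m (length (?K i)) (length (G (Suc i)))"
        using dG(4,5) by (cases i) auto
      show "g \<in> mat_image (e (Suc i))" if "g \<in> carrier_vec (length (G i))"
        "e i *\<^sub>v g = 0\<^sub>v (length (?K i))" for g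
        unfolding dG(3) using that by (intro mat_kernelI[OF ci])
    qed
    then show ?thesis
      by (simp add: D_def)
  qed
  have "mat_image (D (Suc i)) = mat_kernel (D i)" for i
    using ex0 exS by (cases i) auto
  then have ex: "exact_complex [0] ?H D"
    using g0 gS by (auto simp: exact_complex_def)
  have D0: "D 0 *\<^sub>v (a @\<^sub>v g) = d 0 *\<^sub>v a + xpow u \<cdot>\<^sub>v g"
    if "a \<in> carrier_vec (length (F 0))" "g \<in> carrier_vec 1" for a g
  proof -
    have "D 0 *\<^sub>v (a @\<^sub>v g) = (d 0 *\<^sub>v a + U *\<^sub>v g) @\<^sub>v - (0\<^sub>m 0 1 *\<^sub>v g)"
      unfolding D_def using cF(1) cU1 that by (simp add: block_mult_vec)
    also have "\<dots> = d 0 *\<^sub>v a + xpow u \<cdot>\<^sub>v g"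
      using that cF(1) by (intro eq_vecI) (auto simp: Uv)
    finally show ?thesis .
  qed
  have "(\<lambda>v. v $ 0) ` mat_image (D 0) = {f + g * xpow u |f g. f \<in> I}"
  proof (intro equalityI subsetI)
    fix x assume "x \<in> (\<lambda>v. v $ 0) ` mat_image (D 0)"
    then obtain w where w: "w \<in> carrier_vec (length (F 0) + 1)" "x = (D 0 *\<^sub>v w) $ 0"
      using graded_map_carrier[OF g0] by (auto simp: mat_image_def)
    define a g where "a = vec_first w (length (F 0))" and "g = vec_last w 1"
    then have ag: "a \<in> carrier_vec (length (F 0))" "g \<in> carrier_vec 1" and wag: "w = a @\<^sub>v g"
      using vec_first_last_append[OF w(1)] by (auto simp del: One_nat_def)
    have "d 0 *\<^sub>v a \<in> mat_image (d 0)"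
      using ag(1) cF(1) by (intro mat_imageI) auto
    then have "(d 0 *\<^sub>v a) $ 0 \<in> I"
      using imd by simp
    moreover have "x = (d 0 *\<^sub>v a) $ 0 + g $ 0 * xpow u"
      unfolding w(2) wag D0[OF ag] using ag cF(1) by (simp add: mult.commute)
    ultimately show "x \<in> {f + g * xpow u |f g. f \<in> I}" by blast
  next
    fix x assume "x \<in> {f + g * xpow u |f g. f \<in> I}"
    then obtain f g where x: "x = f + g * xpow u" "f \<in> I" by blast
    then obtain a where a: "a \<in> carrier_vec (length (F 0))" "f = (d 0 *\<^sub>v a) $ 0"
      using imF cF(1) by (auto simp: mat_image_def)
    let ?g = "vec 1 (\<lambda>_. g)"
    have "x = (D 0 *\<^sub>v (a @\<^sub>v ?g)) $ 0"
      using x a cF(1) D0[OF a(1), of ?g] by (simp add: mult.commute)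
    moreover have "D 0 *\<^sub>v (a @\<^sub>v ?g) \<in> mat_image (D 0)"
      using append_carrier_vec[OF a(1), of ?g 1] graded_map_carrier[OF g0] by (intro mat_imageI) auto
    ultimately show "x \<in> (\<lambda>v. v $ 0) ` mat_image (D 0)" by blast
  qed
  moreover have "lookup (D (Suc i) $$ (p, q)) 0 = 0"
    if pq: "p < length (?H i)" "q < length (?H (Suc i))" for i p q
  proof -
    have ei: "lookup (e i $$ (p, q)) 0 = 0" if "p < length (?K i)" "q < length (G i)" for p q
      using that e0 minG by (cases i) auto
    have ci: "e i \<in> carrier_mat (length (?K i)) (length (G i))"
      using graded_map_carrier[OF gK] by simp
    show ?thesis
      using pq cF(2)[of i] c\<phi>[of i] ci minF[of p i q] \<phi>0[of p i "q - length (F (Suc i))"]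
        ei[of "p - length (F i)" "q - length (F (Suc i))"]
      by (auto simp: D_def)
  qed
  ultimately have "min_graded_free_resolution ?H D {f + g * xpow u |f g. f \<in> I}"
    using ex by (simp add: min_graded_free_resolution_iff)
  then show ?thesis using that by blast
qed

section \<open>Existence of minimal resolutions\<close>

text \<open>Keeping one vector of \<open>N\<close> for each possible support suffices, since subtracting a multiple of
  it kills a coordinate.\<close>

lemma support_spanning_list:
  fixes N :: "(nat \<Rightarrow> 'k::field) set"
  assumes supp: "\<And>c q. c \<in> N \<Longrightarrow> c q \<noteq> 0 \<Longrightarrow> q < r"
    and diff: "\<And>c z a. c \<in> N \<Longrightarrow> z \<in> N \<Longrightarrow> (\<lambda>q. c q - a * z q) \<in> N"
  shows "\<exists>zs. set zs \<subseteq> N \<and> (\<forall>c \<in> N. \<exists>k. (\<forall>q. c q = (\<Sum>j<length zs. (zs ! j) q * k j)) \<and>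
    (\<forall>j < length zs. k j \<noteq> 0 \<longrightarrow> (\<forall>q. (zs ! j) q \<noteq> 0 \<longrightarrow> c q \<noteq> 0)))"
proof -
  let ?S = "(\<lambda>z. {q. z q \<noteq> 0}) ` N"
  have "?S \<subseteq> Pow {..<r}" using supp by auto
  then have "finite ?S" by (rule finite_subset) simp
  define pick where "pick T = (SOME z. z \<in> N \<and> {q. z q \<noteq> 0} = T)" for T
  obtain zs where zs: "set zs = pick ` ?S"
    using finite_list[OF finite_imageI[OF \<open>finite ?S\<close>, of pick]] by auto
  have pick: "pick T \<in> N \<and> {q. pick T q \<noteq> 0} = T" if "T \<in> ?S" for T
  proof -
    have "\<exists>z. z \<in> N \<and> {q. z q \<noteq> 0} = T" using that by auto
    then show ?thesis unfolding pick_def by (rule someI_ex)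
  qed
  have "\<exists>k. (\<forall>q. c q = (\<Sum>j<length zs. (zs ! j) q * k j)) \<and>
      (\<forall>j < length zs. k j \<noteq> 0 \<longrightarrow> (\<forall>q. (zs ! j) q \<noteq> 0 \<longrightarrow> c q \<noteq> 0))" if "c \<in> N" for c
    using that
  proof (induction "card {q. c q \<noteq> 0}" arbitrary: c rule: less_induct)
    case less
    have fin: "finite {q. c q \<noteq> 0}"
      by (rule finite_subset[of _ "{..<r}"]) (use supp less.prems in auto)
    show ?case
    proof (cases "{q. c q \<noteq> 0} = {}")
      case True
      then show ?thesis by (intro exI[of _ "\<lambda>_. 0"]) auto
    next
      case False
      then obtain i where i: "c i \<noteq> 0" by auto
      define z where "z = pick {q. c q \<noteq> 0}"
      have z: "z \<in> N" "\<And>q. z q \<noteq> 0 \<longleftrightarrow> c q \<noteq> 0"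
        using pick[of "{q. c q \<noteq> 0}"] less.prems by (auto simp: z_def)
      have "z \<in> set zs"
        unfolding zs z_def using less.prems by auto
      then obtain j where j: "j < length zs" "zs ! j = z"
        by (auto simp: in_set_conv_nth)
      define c' where "c' q = c q - c i / z i * z q" for q
      have c'N: "c' \<in> N"
        unfolding c'_def using diff[OF less.prems z(1)] by blast
      have sub: "c' q \<noteq> 0 \<Longrightarrow> c q \<noteq> 0" for q
        using z(2)[of q] by (auto simp: c'_def)
      have "c' i = 0" using z(2)[of i] i by (simp add: c'_def)
      then have "{q. c' q \<noteq> 0} \<subset> {q. c q \<noteq> 0}" using sub i by auto
      then have "card {q. c' q \<noteq> 0} < card {q. c q \<noteq> 0}"
        using fin by (rule psubset_card_mono[rotated])
      then obtain k where k: "\<And>q. c' q = (\<Sum>j<length zs. (zs ! j) q * k j)"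
        "\<And>j q. j < length zs \<Longrightarrow> k j \<noteq> 0 \<Longrightarrow> (zs ! j) q \<noteq> 0 \<Longrightarrow> c' q \<noteq> 0"
        using less.hyps[OF _ c'N] by blast
      let ?k = "\<lambda>l. k l + (if l = j then c i / z i else 0)"
      have "c q = (\<Sum>l<length zs. (zs ! l) q * ?k l)" for q
      proof -
        have "(\<Sum>l<length zs. (zs ! l) q * (if l = j then c i / z i else 0)) =
            (\<Sum>l<length zs. if l = j then z q * (c i / z i) else 0)"
          using j(2) by (intro sum.cong) auto
        also have "\<dots> = z q * (c i / z i)"
          using j by simp
        finally have *: "(\<Sum>l<length zs. (zs ! l) q * (if l = j then c i / z i else 0)) =
            z q * (c i / z i)" .
        have "c q = c' q + z q * (c i / z i)"
          by (simp add: c'_def)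
        then show ?thesis
          by (simp only: distrib_left sum.distrib k(1) *)
      qed
      moreover have "c q \<noteq> 0" if "l < length zs" "?k l \<noteq> 0" "(zs ! l) q \<noteq> 0" for l q
        using that k(2)[of l q] sub[of q] z(2)[of q] j(2) by (cases "l = j") auto
      ultimately show ?thesis by (intro exI[of _ ?k]) blast
    qed
  qed
  moreover have "set zs \<subseteq> N" using zs pick by auto
  ultimately show ?thesis by (intro exI[of _ zs] conjI ballI)
qed

section \<open>Generators of the kernel of a graded map\<close>

lemma single_sum: "Poly_Mapping.single m (sum f I) = (\<Sum>i\<in>I. Poly_Mapping.single m (f i))"
  by (rule poly_mapping_eqI) (simp add: lookup_sum lookup_single when_def sum.If_cases)

lemma single_diff_mult:
  fixes x y :: "'k::field"
  assumes "x \<noteq> 0 \<Longrightarrow> edvd a b" "y \<noteq> 0 \<Longrightarrow> edvd b c"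
  shows "Poly_Mapping.single (b - a) x * Poly_Mapping.single (c - b) y =
      Poly_Mapping.single (c - a) (x * y)"
proof (cases "x = 0 \<or> y = 0")
  case False
  then have "a + (b - a) = b" "b + (c - b) = c"
    using assms by (auto simp: edvd_add_diff)
  then have "b - a + (c - b) = c - a"
    by (metis add.assoc add_diff_cancel_left')
  then show ?thesis by (simp add: mult_single)
qed auto

text \<open>Inserting 0 keeps \<open>Max\<close> defined for the empty set, whose least common
  multiple is the monomial 1.\<close>

definition lcm_expo :: "'v::finite expo set \<Rightarrow> 'v expo"
  where "lcm_expo S = Abs_poly_mapping (\<lambda>p. Max (insert 0 ((\<lambda>a. lookup a p) ` S)))"

lemma edvd_lcm_expo_iff: "finite S \<Longrightarrow> edvd (lcm_expo S) b \<longleftrightarrow> (\<forall>a \<in> S. edvd a b)"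
  by (auto simp: lcm_expo_def edvd_def)

text \<open>In each degree the kernel consists of the elements of \<open>N\<close> supported on the basis elements whose
  degrees divide the given one, where \<open>N\<close> is the kernel of the coefficient matrix.\<close>

lemma kernel_graded_cover:
  fixes A :: "('v::finite, 'k::field) mpoly mat"
  assumes A: "graded_map F G A"
  obtains H B where "graded_map H F B" "mat_image B = mat_kernel A"
proof -
  note cA = graded_map_carrier[OF A]
  \<comment> \<open>A homogeneous entry is determined by one scalar; \<open>a\<close> is the matrix
    of these scalars, with 0 where the degrees admit no term.\<close>
  define a where "a p q = (if edvd (G ! p) (F ! q) then lookup (A $$ (p, q)) (F ! q - G ! p) else 0)"
      for p q
  have a0: "a p q \<noteq> 0 \<Longrightarrow> edvd (G ! p) (F ! q)" for p q
    by (auto simp: a_def split: if_splits)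
  have Aa: "A $$ (p, q) = Poly_Mapping.single (F ! q - G ! p) (a p q)"
    if "p < length G" "q < length F" for p q
    using hpart_self[OF graded_mapD[OF A that]] by (simp add: hpart_def a_def split: if_splits)
  define N where "N = {c. (\<forall>q. c q \<noteq> 0 \<longrightarrow> q < length F) \<and>
      (\<forall>p < length G. (\<Sum>q<length F. a p q * c q) = 0)}"
  have diff: "(\<lambda>q. c q - x * z q) \<in> N" if "c \<in> N" "z \<in> N" for c z x
  proof -
    have "(\<Sum>q<length F. a p q * (c q - x * z q)) =
        (\<Sum>q<length F. a p q * c q) - x * (\<Sum>q<length F. a p q * z q)" for p
      by (simp add: right_diff_distrib sum_subtractf sum_distrib_left mult.left_commute)
    then show ?thesis
      using that unfolding N_def by auto (metis mult_zero_right)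
  qed
  have supp: "q < length F" if "c \<in> N" "c q \<noteq> 0" for c q
    using that by (simp add: N_def)
  have "\<exists>zs. set zs \<subseteq> N \<and> (\<forall>c \<in> N. \<exists>k. (\<forall>q. c q = (\<Sum>j<length zs. (zs ! j) q * k j)) \<and>
    (\<forall>j < length zs. k j \<noteq> 0 \<longrightarrow> (\<forall>q. (zs ! j) q \<noteq> 0 \<longrightarrow> c q \<noteq> 0)))"
  proof (rule support_spanning_list)
    show "q < length F" if "c \<in> N" "c q \<noteq> 0" for c q
      using that by (rule supp)
    show "(\<lambda>q. c q - x * z q) \<in> N" if "c \<in> N" "z \<in> N" for c z x
      using that by (rule diff)
  qed
  then obtain zs where zs: "set zs \<subseteq> N"
    and span: "\<forall>c \<in> N. \<exists>k. (\<forall>q. c q = (\<Sum>j<length zs. (zs ! j) q * k j)) \<and>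
      (\<forall>j < length zs. k j \<noteq> 0 \<longrightarrow> (\<forall>q. (zs ! j) q \<noteq> 0 \<longrightarrow> c q \<noteq> 0))"
    by (elim exE conjE)
  \<comment> \<open>The least degree in which the scalar vector \<open>z\<close> is realized by
    monomial multiples of the basis elements.\<close>
  define deg where "deg z = lcm_expo ((!) F ` {q. z q \<noteq> 0})" for z :: "nat \<Rightarrow> 'k"
  have deg: "edvd (deg z) b \<longleftrightarrow> (\<forall>q. z q \<noteq> 0 \<longrightarrow> edvd (F ! q) b)" if "z \<in> N" for z b
  proof -
    have "finite {q. z q \<noteq> 0}"
      by (rule finite_subset[of _ "{..<length F}"]) (use that in \<open>auto simp: N_def\<close>)
    then show ?thesis by (auto simp: deg_def edvd_lcm_expo_iff)
  qed
  define H where "H = map deg zs"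
  define B where "B = mat (length F) (length H)
      (\<lambda>(q, j). Poly_Mapping.single (H ! j - F ! q) ((zs ! j) q))"
  have cB: "B \<in> carrier_mat (length F) (length H)" by (simp add: B_def)
  have z: "zs ! j \<in> N" if "j < length H" for j
    using that zs by (auto simp: H_def)
  have zF: "edvd (F ! q) (H ! j)" if "j < length H" "(zs ! j) q \<noteq> 0" for j q
    using deg[OF z[OF that(1)], of "H ! j"] that by (simp add: H_def)
  have gB: "graded_map H F B"
  proof (rule graded_mapI)
    fix q j m assume "q < length F" "j < length H" "m \<in> keys (B $$ (q, j))"
    then show "F ! q + m = H ! j"
      using zF by (auto simp: B_def edvd_add_diff split: if_splits)
  qed (rule cB)
  have Ac: "A $$ (p, q) * Poly_Mapping.single (b - F ! q) x =
      Poly_Mapping.single (b - G ! p) (a p q * x)"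
    if "p < length G" "q < length F" "x \<noteq> 0 \<Longrightarrow> edvd (F ! q) b" for p q b x
    unfolding Aa[OF that(1,2)] using a0 that(3) by (rule single_diff_mult)
  have "A * B = 0\<^sub>m (length G) (length H)"
  proof (rule eq_matI)
    fix p j assume "p < dim_row (0\<^sub>m (length G) (length H) :: ('v, 'k) mpoly mat)"
      "j < dim_col (0\<^sub>m (length G) (length H) :: ('v, 'k) mpoly mat)"
    then have pj: "p < length G" "j < length H" by auto
    have "(A * B) $$ (p, j) = (\<Sum>q<length F. Poly_Mapping.single (H ! j - G ! p) (a p q * (zs ! j) q))"
      unfolding index_mult_mat_sum[OF cA cB pj]
      using pj zF by (intro sum.cong refl) (auto simp: B_def intro!: Ac)
    also have "\<dots> = 0"
      using z[OF pj(2)] pj(1) by (simp add: N_def flip: single_sum)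
    finally show "(A * B) $$ (p, j) = 0\<^sub>m (length G) (length H) $$ (p, j)"
      using pj by simp
  qed (use cA cB in auto)
  then have "mat_image B \<subseteq> mat_kernel A"
    using mat_image_subset_kernel_iff[OF cA cB] by simp
  moreover have "mat_kernel A \<subseteq> mat_image B"
  proof
    fix v assume "v \<in> mat_kernel A"
    then have v: "v \<in> carrier_vec (length F)" "A *\<^sub>v v = 0\<^sub>v (length G)"
      using mat_kernelD[OF cA] by blast+
    \<comment> \<open>\<open>c b\<close> collects the scalars of the degree \<open>b\<close>
      component of \<open>v\<close>; the vanishing of \<open>A *\<^sub>v v\<close> splits into one
      scalar system for each \<open>b\<close>.\<close>
    define c where "c b q = (if q < length F \<and> edvd (F ! q) b then lookup (v $ q) (b - F ! q) else 0)"
        for b q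
    have hc: "hpart (F ! q) b (v $ q) = Poly_Mapping.single (b - F ! q) (c b q)" if "q < length F"
        for q b
      using that by (simp add: hpart_def c_def)
    have c0: "c b q \<noteq> 0 \<Longrightarrow> edvd (F ! q) b" for b q
      by (auto simp: c_def split: if_splits)
    have "c b \<in> N" for b
    proof -
      have "(\<Sum>q<length F. a p q * c b q) = 0" if p: "p < length G" for p
      proof -
        have "0 = hpart (G ! p) b ((A *\<^sub>v v) $ p)"
          using v p by simp
        also have "\<dots> = (\<Sum>q<length F. hpart (G ! p) b (A $$ (p, q) * v $ q))"
          unfolding index_mult_vec_sum[OF cA v(1) p] by (rule hpart_sum)
        also have "\<dots> = (\<Sum>q<length F. A $$ (p, q) * hpart (F ! q) b (v $ q))"
          using graded_mapD[OF A p] by (intro sum.cong refl mult_hpart[symmetric]) auto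
        also have "\<dots> = (\<Sum>q<length F. Poly_Mapping.single (b - G ! p) (a p q * c b q))"
          using p c0 by (intro sum.cong refl) (auto simp: hc intro!: Ac)
        also have "\<dots> = Poly_Mapping.single (b - G ! p) (\<Sum>q<length F. a p q * c b q)"
          by (rule single_sum[symmetric])
        finally have "lookup (Poly_Mapping.single (b - G ! p) (\<Sum>q<length F. a p q * c b q)) (b - G ! p)
            = 0"
          by simp
        then show ?thesis by simp
      qed
      then show ?thesis by (auto simp: N_def c_def split: if_splits)
    qed
    then have "\<forall>b. \<exists>k. (\<forall>q. c b q = (\<Sum>j<length zs. (zs ! j) q * k j)) \<and>
      (\<forall>j < length zs. k j \<noteq> 0 \<longrightarrow> (\<forall>q. (zs ! j) q \<noteq> 0 \<longrightarrow> c b q \<noteq> 0))"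
      using span by blast
    then obtain k where kk: "\<forall>b. (\<forall>q. c b q = (\<Sum>j<length zs. (zs ! j) q * k b j)) \<and>
      (\<forall>j < length zs. k b j \<noteq> 0 \<longrightarrow> (\<forall>q. (zs ! j) q \<noteq> 0 \<longrightarrow> c b q \<noteq> 0))"
      unfolding choice_iff by (elim exE)
    have k1: "c b q = (\<Sum>j<length zs. (zs ! j) q * k b j)" for b q
      using conjunct1[OF spec[OF kk]] by (rule spec)
    have k2: "c b q \<noteq> 0" if "j < length zs" "k b j \<noteq> 0" "(zs ! j) q \<noteq> 0" for b j q
      using conjunct2[OF spec[OF kk, of b]] that by blast
    \<comment> \<open>Here the support condition on the coefficients pays off: a vector of
      \<open>zs\<close> that occurs in the expansion of \<open>c b\<close> is supported within
      \<open>c b\<close>, so its degree divides \<open>b\<close> and the required multiple of its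
      column exists.\<close>
    have Hb: "edvd (H ! j) b" if "j < length H" "k b j \<noteq> 0" for j b
      using that deg[OF z[OF that(1)], of b] k2[of j b] c0 by (auto simp: H_def)
    define D where "D = (\<Union>q<length F. (+) (F ! q) ` keys (v $ q))"
    have fD: "finite D" by (auto simp: D_def)
    define w where "w = vec (length H) (\<lambda>j. \<Sum>b\<in>D. Poly_Mapping.single (b - H ! j) (k b j))"
    have cw: "w \<in> carrier_vec (length H)" by (simp add: w_def)
    have "v = B *\<^sub>v w"
    proof (rule eq_vecI)
      fix q assume "q < dim_vec (B *\<^sub>v w)"
      then have q: "q < length F" using cB by simp
      have Bk: "B $$ (q, j) * Poly_Mapping.single (b - H ! j) (k b j) =
          Poly_Mapping.single (b - F ! q) ((zs ! j) q * k b j)" if "j < length H" for j b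
        using q that zF Hb by (simp add: B_def single_diff_mult)
      have "(B *\<^sub>v w) $ q = (\<Sum>j<length H. \<Sum>b\<in>D. Poly_Mapping.single (b - F ! q) ((zs ! j) q * k b j))"
        unfolding index_mult_vec_sum[OF cB cw q]
        by (intro sum.cong refl) (simp add: w_def sum_distrib_left Bk)
      also have "\<dots> = (\<Sum>b\<in>D. \<Sum>j<length H. Poly_Mapping.single (b - F ! q) ((zs ! j) q * k b j))"
        by (rule sum.swap)
      also have "\<dots> = (\<Sum>b\<in>D. hpart (F ! q) b (v $ q))"
        using q k1 by (simp add: hc H_def flip: single_sum)
      also have "\<dots> = v $ q"
        using q by (intro sum_hpart[OF fD]) (auto simp: D_def)
      finally show "v $ q = (B *\<^sub>v w) $ q" ..
    qed (use v cB in auto)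
    then show "v \<in> mat_image B"
      using cw cB by (auto simp: mat_image_def)
  qed
  ultimately show ?thesis
    using that gB by blast
qed

section \<open>Removal of redundant generators\<close>

text \<open>Quantifying over all graded relations \<open>C\<close> lets the condition be secured
  before the next map of the resolution is chosen; that map is then such a \<open>C\<close>.\<close>

definition irredundant :: "'v expo list \<Rightarrow> ('v, 'k::field) mpoly mat \<Rightarrow> bool"
  where "irredundant H B \<longleftrightarrow> (\<forall>F C p q. graded_map F H C \<longrightarrow> B * C = 0\<^sub>m (dim_row B) (length F) \<longrightarrow>
    p < length H \<longrightarrow> q < length F \<longrightarrow> lookup (C $$ (p, q)) 0 = 0)"

text \<open>Nakayama's lemma by counting: take a cover with the fewest generators. A relation with a
  unit entry solves for one column of \<open>B\<close> in terms of the others, and deleting that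
  column gives a smaller cover.\<close>

lemma minimal_graded_cover:
  fixes B0 :: "('v, 'k::field) mpoly mat"
  assumes "graded_map H0 G B0" "mat_image B0 = M"
  obtains H B where "graded_map H G B" "mat_image B = M" "irredundant H B"
proof -
  let ?P = "\<lambda>H. \<exists>B :: ('v, 'k) mpoly mat. graded_map H G B \<and> mat_image B = M"
  obtain H where H: "?P H" and min: "\<And>H'. ?P H' \<Longrightarrow> length H \<le> length H'"
    using ex_has_least_nat[of ?P H0 length] assms by blast
  then obtain B :: "('v, 'k) mpoly mat" where B: "graded_map H G B" "mat_image B = M" by blast
  note cB = graded_map_carrier[OF B(1)]
  have "lookup (C $$ (p, q)) 0 = 0"
    if C: "graded_map F H C" and BC: "B * C = 0\<^sub>m (length G) (length F)"
      and p: "p < length H" and q: "q < length F" for F C p q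
  proof (rule ccontr)
    assume c: "lookup (C $$ (p, q)) 0 \<noteq> 0"
    define x where "x = lookup (C $$ (p, q)) 0"
    note cC = graded_map_carrier[OF C]
    have "0 \<in> keys (C $$ (p, q))" using c by (simp add: in_keys_iff)
    with graded_mapD[OF C p q] have "H ! p + 0 = F ! q" by (rule bspec)
    then have "H ! p = F ! q" by simp
    then have Cpq: "C $$ (p, q) = Poly_Mapping.single 0 x"
      using hpart_self[OF graded_mapD[OF C p q]] by (simp add: hpart_def x_def)
    let ?n = "length H - 1"
    define s where "s j = (if j < p then j else Suc j)" for j
    have s: "bij_betw s {..<?n} ({..<length H} - {p})"
    proof (rule bij_betwI[where g = "\<lambda>i. if i < p then i else i - 1"])
      show "s \<in> {..<?n} \<rightarrow> {..<length H} - {p}"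
      proof (rule Pi_I)
        fix j assume "j \<in> {..<?n}"
        then have "j < length H - 1" by simp
        then show "s j \<in> {..<length H} - {p}"
          using p unfolding s_def by (cases "j < p") auto
      qed
      show "(\<lambda>i. if i < p then i else i - 1) \<in> {..<length H} - {p} \<rightarrow> {..<?n}"
      proof (rule Pi_I)
        fix i assume "i \<in> {..<length H} - {p}"
        then show "(if i < p then i else i - 1) \<in> {..<?n}"
          using p by (cases "i < p") auto
      qed
      show "(if s j < p then s j else s j - 1) = j" for j
        by (cases "j < p") (auto simp: s_def)
      show "s (if i < p then i else i - 1) = i" if "i \<in> {..<length H} - {p}" for i
        using that by (cases "i < p") (auto simp: s_def)
    qed
    have sj: "s j < length H" "s j \<noteq> p" if "j < ?n" for j
      using that p by (auto simp: s_def)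
    define H' where "H' = map (\<lambda>j. H ! s j) [0..<?n]"
    define B' where "B' = mat (length G) ?n (\<lambda>(r, j). B $$ (r, s j))"
    have cB': "B' \<in> carrier_mat (length G) ?n" by (simp add: B'_def)
    have gB': "graded_map H' G B'"
    proof (rule graded_mapI)
      fix r j m assume "r < length G" "j < length H'" "m \<in> keys (B' $$ (r, j))"
      then show "G ! r + m = H' ! j"
        using graded_mapD[OF B(1), of r "s j"] sj by (simp add: H'_def B'_def)
    qed (simp add: H'_def B'_def)
    define S where "S = mat (length H) ?n (\<lambda>(i, j). if i = s j then 1 else 0 :: ('v, 'k) mpoly)"
    have cS: "S \<in> carrier_mat (length H) ?n" by (simp add: S_def)
    have "B * S = B'"
    proof (rule eq_matI)
      fix r j assume "r < dim_row B'" "j < dim_col B'"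
      then have rj: "r < length G" "j < ?n" by (auto simp: B'_def)
      have "(B * S) $$ (r, j) = (\<Sum>i<length H. if i = s j then B $$ (r, i) else 0)"
        unfolding index_mult_mat_sum[OF cB cS rj] using rj by (intro sum.cong refl) (auto simp: S_def)
      then show "(B * S) $$ (r, j) = B' $$ (r, j)"
        using rj sj by (simp add: B'_def)
    qed (use cB cS in \<open>auto simp: B'_def\<close>)
    then have 1: "mat_image B' \<subseteq> mat_image B"
      using mat_image_mult[OF cB cS] by simp
    \<comment> \<open>Column \<open>q\<close> of the relation, divided by \<open>- x\<close>,
      expresses column \<open>p\<close> of \<open>B\<close> through the others. \<open>R\<close>
      records this expression, so multiplying by it restores the deleted column.\<close>
    define y :: "('v, 'k) mpoly" where "y = Poly_Mapping.single 0 (- 1 / x)"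
    define R where "R = mat ?n (length H) (\<lambda>(j, i). if i = p then y * C $$ (s j, q)
        else if i = s j then 1 else 0)"
    have cR: "R \<in> carrier_mat ?n (length H)" by (simp add: R_def)
    have "B' * R = B"
    proof (rule eq_matI)
      fix r i assume "r < dim_row B" "i < dim_col B"
      then have ri: "r < length G" "i < length H" using cB by auto
      show "(B' * R) $$ (r, i) = B $$ (r, i)"
      proof (cases "i = p")
        case True
        have "(B' * R) $$ (r, i) = (\<Sum>j<?n. y * (B $$ (r, s j) * C $$ (s j, q)))"
          unfolding index_mult_mat_sum[OF cB' cR ri] using ri True
          by (intro sum.cong refl) (auto simp: R_def B'_def mult.left_commute)
        also have "\<dots> = (\<Sum>i\<in>{..<length H} - {p}. y * (B $$ (r, i) * C $$ (i, q)))"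
          by (rule sum.reindex_bij_betw[OF s])
        also have "\<dots> = y * ((\<Sum>i<length H. B $$ (r, i) * C $$ (i, q)) - B $$ (r, p) * C $$ (p, q))"
          using p by (subst sum_distrib_left[symmetric]) (simp add: sum_diff1)
        also have "(\<Sum>i<length H. B $$ (r, i) * C $$ (i, q)) = 0"
          using index_mult_mat_sum[OF cB cC ri(1) q] BC ri(1) q by simp
        also have "y * (0 - B $$ (r, p) * C $$ (p, q)) =
            (- (y * Poly_Mapping.single 0 x)) * B $$ (r, p)"
          by (simp only: Cpq diff_0 mult_minus_right mult_minus_left mult_ac)
        also have "- (y * Poly_Mapping.single 0 x) = 1"
          using c by (simp add: y_def mult_single x_def flip: single_uminus)
        finally show ?thesis using True by simp
      next
        case False
        have "(B' * R) $$ (r, i) = (\<Sum>j<?n. if i = s j then B $$ (r, s j) else 0)"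
          unfolding index_mult_mat_sum[OF cB' cR ri] using ri False
          by (intro sum.cong refl) (auto simp: R_def B'_def)
        also have "\<dots> = (\<Sum>l\<in>{..<length H} - {p}. if i = l then B $$ (r, l) else 0)"
          by (rule sum.reindex_bij_betw[OF s])
        finally show ?thesis using ri False by simp
      qed
    qed (use cB cR in \<open>auto simp: B'_def\<close>)
    then have "mat_image B \<subseteq> mat_image B'"
      using mat_image_mult[OF cB' cR] by simp
    then have "?P H'" using 1 gB' B(2) by blast
    then have "length H \<le> length H'" by (rule min)
    then show False using p by (simp add: H'_def)
  qed
  then have "irredundant H B"
    using cB by (simp add: irredundant_def)
  then show ?thesis using that B by blast
qed

text \<open>Cover successive kernels and prune each cover. As \<open>d (Suc i)\<close> is a graded
  relation for \<open>d i\<close>, irredundance of \<open>d i\<close> removes the constant terms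
  from \<open>d (Suc i)\<close>. The augmentation is pruned too, since minimality of
  \<open>d (Suc 0)\<close> rests on it.\<close>

theorem min_graded_free_resolution_exists:
  fixes U :: "'v::finite expo set"
  assumes "finite U"
  obtains F d where "min_graded_free_resolution F d (ideal_gen (xpow ` U) :: ('v, 'k::field) mpoly set)"
proof -
  let ?J = "ideal_gen (xpow ` U) :: ('v, 'k) mpoly set"
  obtain us where us: "set us = U" "distinct us"
    using finite_distinct_list[OF assms] by blast
  define A0 :: "('v, 'k) mpoly mat" where "A0 = mat 1 (length us) (\<lambda>(i, j). xpow (us ! j))"
  have gA0: "graded_map us [0] A0"
    by (rule graded_mapI) (auto simp: A0_def xpow_def)
  have cA0: "A0 \<in> carrier_mat 1 (length us)" by (simp add: A0_def)
  have inj: "inj_on (xpow :: _ \<Rightarrow> ('v, 'k) mpoly) U"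
    by (rule inj_onI) (metis keys_single singleton_inject xpow_def zero_neq_one)
  have sumU: "(\<Sum>u\<in>U. g u * xpow u) = (\<Sum>j<length us. g (us ! j) * xpow (us ! j))"
    for g :: "_ \<Rightarrow> ('v, 'k) mpoly"
    using us sum.reindex_bij_betw[OF bij_betw_nth[OF us(2) refl refl], of "\<lambda>u. g u * xpow u"] by simp
  have J: "?J = {\<Sum>j<length us. xpow (us ! j) * w j |w. True}" (is "_ = ?R")
  proof (intro equalityI subsetI)
    fix f assume "f \<in> ?J"
    then obtain h where "f = (\<Sum>v\<in>xpow ` U. h v * v)"
      unfolding ideal_gen_def using poly_module.span_finite[of "xpow ` U"] assms by auto
    then have "f = (\<Sum>u\<in>U. h (xpow u) * xpow u)"
      by (simp add: sum.reindex[OF inj])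
    then have "f = (\<Sum>j<length us. xpow (us ! j) * h (xpow (us ! j)))"
      using sumU[of "\<lambda>u. h (xpow u)"] by (simp add: mult.commute)
    then show "f \<in> ?R"
      by (intro CollectI exI[of _ "\<lambda>j. h (xpow (us ! j))"]) simp
  next
    fix f assume "f \<in> ?R"
    then obtain w where "f = (\<Sum>j<length us. w j * xpow (us ! j))"
      by (auto simp: mult.commute)
    moreover have "xpow (us ! j) \<in> xpow ` U" if "j < length us" for j
      using that us by auto
    ultimately show "f \<in> ?J"
      unfolding ideal_gen_def
      by (auto intro!: poly_module.span_sum poly_module.span_scale[OF poly_module.span_base])
  qed
  have "(\<lambda>v. v $ 0) ` mat_image A0 = ?J"
  proof (intro equalityI subsetI)
    fix x assume "x \<in> (\<lambda>v. v $ 0) ` mat_image A0"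
    then obtain w where "w \<in> carrier_vec (length us)" "x = (A0 *\<^sub>v w) $ 0"
      using cA0 by (auto simp: mat_image_def)
    then show "x \<in> ?J"
      using index_mult_vec_sum[OF cA0, of w 0] unfolding J by (auto simp: A0_def)
  next
    fix x assume "x \<in> ?J"
    then obtain w where w: "x = (\<Sum>j<length us. xpow (us ! j) * w j)" unfolding J by blast
    then have x: "x = (A0 *\<^sub>v vec (length us) w) $ 0"
      using index_mult_vec_sum[OF cA0, of "vec (length us) w" 0] by (simp add: A0_def)
    show "x \<in> (\<lambda>v. v $ 0) ` mat_image A0"
      unfolding x using cA0 by (intro imageI mat_imageI) auto
  qed
  then have imA0: "mat_image A0 = {v \<in> carrier_vec 1. v $ 0 \<in> ?J}"
    by (rule mat_image_augmentation[OF cA0])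
  \<comment> \<open>A state holds the source degrees, the target degrees and the matrix of one map,
    so that dependent choice can glue the target of each map to the source of the one
    before.\<close>
  let ?P = "\<lambda>(i :: nat) (s :: 'v expo list \<times> 'v expo list \<times> ('v, 'k) mpoly mat).
    irredundant (fst s) (snd (snd s)) \<and> graded_map (fst s) (fst (snd s)) (snd (snd s)) \<and>
    (i = 0 \<longrightarrow> fst (snd s) = [0] \<and> mat_image (snd (snd s)) = mat_image A0)"
  have "\<exists>f. \<forall>i::nat. ?P i (f i) \<and> (fst (snd (f (Suc i))) = fst (f i) \<and>
    mat_image (snd (snd (f (Suc i)))) = mat_kernel (snd (snd (f i))))"
  proof (rule dependent_nat_choice)
    obtain H B where "graded_map H [0] B" "mat_image B = mat_image A0" "irredundant H B"
      using minimal_graded_cover[OF gA0 refl] .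
    then show "\<exists>s. ?P 0 s"
      by (intro exI[of _ "(H, [0], B)"]) auto
  next
    fix s :: "'v expo list \<times> 'v expo list \<times> ('v, 'k) mpoly mat" and i :: nat
    assume s: "?P i s"
    obtain H G B where s_eq: "s = (H, G, B)" by (cases s)
    then have gB: "graded_map H G B" using s by simp
    obtain H1 B1 where "graded_map H1 H B1" "mat_image B1 = mat_kernel B"
      using kernel_graded_cover[OF gB] .
    then obtain H2 B2 where "graded_map H2 H B2" "mat_image B2 = mat_kernel B" "irredundant H2 B2"
      by (rule minimal_graded_cover)
    then show "\<exists>s'. ?P (Suc i) s' \<and> (fst (snd s') = fst s \<and>
        mat_image (snd (snd s')) = mat_kernel (snd (snd s)))"
      using s_eq by (intro exI[of _ "(H2, H, B2)"]) auto
  qed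
  then obtain f :: "nat \<Rightarrow> 'v expo list \<times> 'v expo list \<times> ('v, 'k) mpoly mat"
    where ff: "\<forall>i. ?P i (f i) \<and> (fst (snd (f (Suc i))) = fst (f i) \<and>
      mat_image (snd (snd (f (Suc i)))) = mat_kernel (snd (snd (f i))))"
    by (elim exE)
  have f: "?P i (f i)" "fst (snd (f (Suc i))) = fst (f i)"
    "mat_image (snd (snd (f (Suc i)))) = mat_kernel (snd (snd (f i)))" for i
    using spec[OF ff, of i] by blast+
  define F d where "F i = fst (f i)" and "d i = snd (snd (f i))" for i
  have f0: "fst (snd (f 0)) = [0]" "mat_image (d 0) = mat_image A0"
    using f(1)[of 0] by (auto simp: d_def)
  have gd: "graded_map (F i) (fst (snd (f i))) (d i)" for i
    using f(1)[of i] by (auto simp: F_def d_def)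
  have ex: "exact_complex [0] F d"
    unfolding exact_complex_def
  proof (intro conjI allI)
    show "graded_map (F 0) [0] (d 0)" using gd[of 0] f0 by simp
    show "graded_map (F (Suc i)) (F i) (d (Suc i))" for i
      using gd[of "Suc i"] f(2) by (simp add: F_def)
    show "mat_image (d (Suc i)) = mat_kernel (d i)" for i
      using f(3) by (simp add: d_def)
  qed
  have "lookup (d (Suc i) $$ (p, q)) 0 = 0" if "p < length (F i)" "q < length (F (Suc i))" for i p q
  proof -
    have "irredundant (F i) (d i)"
      using f(1)[of i] by (simp add: F_def d_def)
    moreover have "graded_map (F (Suc i)) (F i) (d (Suc i))"
      by (rule exact_complexD[OF ex])
    moreover have "d i * d (Suc i) = 0\<^sub>m (dim_row (d i)) (length (F (Suc i)))"
    proof (cases i)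
      case 0
      then show ?thesis
        using exact_complexD(4)[OF ex] graded_map_carrier[OF exact_complexD(1)[OF ex]] by simp
    next
      case (Suc n)
      then show ?thesis
        using exact_complexD(5)[OF ex, of n] graded_map_carrier[OF exact_complexD(2)[OF ex, of n]]
          by simp
    qed
    ultimately show ?thesis using that unfolding irredundant_def by blast
  qed
  moreover have "(\<lambda>v. v $ 0) ` mat_image (d 0) = ?J"
    unfolding f0(2) by fact
  ultimately have "min_graded_free_resolution F d ?J"
    using ex by (simp add: min_graded_free_resolution_iff)
  then show ?thesis using that by blast
qed

section \<open>Shift ideals computed from a given resolution\<close>

text \<open>One minimal resolution suffices to make the choice inside \<open>betti\<close> a minimal
  resolution too; uniqueness, used in both directions, then identifies the degrees.\<close>

lemma betti_nonzero_iff: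
  fixes J :: "('v, 'k::field) mpoly set"
  assumes "min_graded_free_resolution F d J"
  shows "betti J k a \<noteq> 0 \<longleftrightarrow> a \<in> set (F k)"
proof -
  let ?F = "SOME F. \<exists>d. min_graded_free_resolution F d J"
  obtain d' where "min_graded_free_resolution ?F d' J"
    using someI_ex[of "\<lambda>F. \<exists>d. min_graded_free_resolution F d J"] assms by blast
  then have "set (?F k) = set (F k)"
    using min_graded_free_resolution_degrees_subset assms by blast
  then show ?thesis by (simp add: betti_def count_list_0_iff)
qed

lemma homological_shift_ideal_eq:
  fixes J :: "('v, 'k::field) mpoly set"
  assumes "min_graded_free_resolution F d J"
  shows "homological_shift_ideal k J = ideal_gen (xpow ` set (F k))"
proof -
  have "{xpow a |a. a \<in> set (F k)} = (xpow ` set (F k) :: ('v, 'k) mpoly set)" by blast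
  then show ?thesis
    by (simp only: homological_shift_ideal_def betti_nonzero_iff[OF assms])
qed

text \<open>Each entry of \<open>d 0\<close> is a nonzero scalar times the monomial of its degree,
  so the degrees in \<open>F 0\<close> give generators of the ideal. This holds for any finite
  \<open>U\<close>, before anything is known about linear quotients.\<close>

lemma homological_shift_ideal_0:
  fixes U :: "'v::finite expo set"
  assumes U: "finite U"
  shows "homological_shift_ideal 0 (ideal_gen (xpow ` U)) =
      (ideal_gen (xpow ` U) :: ('v, 'k::field) mpoly set)"
proof -
  let ?J = "ideal_gen (xpow ` U) :: ('v, 'k) mpoly set"
  obtain F d where m: "min_graded_free_resolution F d ?J"
    using min_graded_free_resolution_exists[OF U] .
  then have ex: "exact_complex [0] F d" and im: "(\<lambda>v. v $ 0) ` mat_image (d 0) = ?J"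
    and min: "\<And>p q. p < length (F 0) \<Longrightarrow> q < length (F (Suc 0)) \<Longrightarrow> lookup (d (Suc 0) $$ (p, q)) 0 = 0"
    by (auto simp: min_graded_free_resolution_iff)
  note D = exact_complexD[OF ex]
  note c0 = graded_map_carrier[OF D(1)] and c1 = graded_map_carrier[OF D(2)]
  have d0: "d 0 $$ (0, q) = Poly_Mapping.single (F 0 ! q) (lookup (d 0 $$ (0, q)) (F 0 ! q))"
    if "q < length (F 0)" for q
    using hpart_self[OF graded_mapD[OF D(1), of 0 q]] that by (simp add: hpart_def edvd_def)
  have "ideal_gen (xpow ` set (F 0)) = ?J"
  proof (intro equalityI subsetI)
    have "xpow ` set (F 0) \<subseteq> ?J"
    proof safe
      fix b assume "b \<in> set (F 0)"
      then obtain q where q: "q < length (F 0)" "b = F 0 ! q" by (auto simp: in_set_conv_nth)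
      define x where "x = lookup (d 0 $$ (0, q)) b"
      \<comment> \<open>If \<open>x\<close> were 0, a basis vector would lie in the kernel of
        \<open>d 0\<close>, hence in the image of \<open>d (Suc 0)\<close>. By minimality vectors in
        that image have entries without constant term, while the basis vector has an entry
        1.\<close>
      have "x \<noteq> 0"
      proof
        assume "x = 0"
        then have "d 0 $$ (0, q) = 0" using d0[OF q(1)] q(2) by (simp add: x_def)
        then have "d 0 *\<^sub>v unit_vec (length (F 0)) q = 0\<^sub>v 1"
          using c0 q(1) by (intro eq_vecI) (auto simp: scalar_prod_right_unit)
        then have "unit_vec (length (F 0)) q \<in> mat_image (d (Suc 0))"
          unfolding D(3) using c0 by (intro mat_kernelI) auto
        then obtain w where w: "w \<in> carrier_vec (length (F (Suc 0)))"
          "unit_vec (length (F 0)) q = d (Suc 0) *\<^sub>v w"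
          using c1[of 0] by (auto simp: mat_image_def)
        have "1 = lookup (unit_vec (length (F 0)) q $ q) (0 :: 'v expo)"
          using q(1) by simp
        also have "\<dots> = (0 :: 'k)"
          unfolding w(2) index_mult_vec_sum[OF c1 w(1) q(1)]
          using min q(1) by (simp add: lookup_sum lookup_mult_0)
        finally show False by simp
      qed
      have "d 0 $$ (0, q) = col (d 0) q $ 0" using c0 q(1) by simp
      also have "\<dots> \<in> ?J"
        unfolding im[symmetric] using c0 q(1) by (intro imageI col_in_mat_image) auto
      finally have "Poly_Mapping.single b x \<in> ?J" using d0[OF q(1)] q(2) by (simp add: x_def)
      then have "Poly_Mapping.single 0 (1 / x) * Poly_Mapping.single b x \<in> ?J"
        unfolding ideal_gen_def by (rule poly_module.span_scale)
      then show "xpow b \<in> ?J" using \<open>x \<noteq> 0\<close> by (simp add: mult_single xpow_def)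
    qed
    then have "ideal_gen (xpow ` set (F 0)) \<subseteq> ?J"
      unfolding ideal_gen_def by (rule poly_module.span_minimal[OF _ poly_module.subspace_span])
    then show "f \<in> ?J" if "f \<in> ideal_gen (xpow ` set (F 0))" for f
      using that by blast
  next
    fix f assume "f \<in> ?J"
    then have "f \<in> (\<lambda>v. v $ 0) ` mat_image (d 0)"
      using im by simp
    then obtain w where w: "w \<in> carrier_vec (length (F 0))" "f = (d 0 *\<^sub>v w) $ 0"
      using c0 by (auto simp: mat_image_def)
    have "d 0 $$ (0, q) * w $ q \<in> poly_module.span (xpow ` set (F 0))" if q: "q < length (F 0)" for q
    proof -
      define x where "x = lookup (d 0 $$ (0, q)) (F 0 ! q)"
      have "d 0 $$ (0, q) * w $ q = (Poly_Mapping.single 0 x * w $ q) * xpow (F 0 ! q)"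
      proof -
        have "d 0 $$ (0, q) = Poly_Mapping.single 0 x * xpow (F 0 ! q)"
          using d0[OF q] by (simp add: x_def xpow_def mult_single)
        then show ?thesis by (simp only: mult_ac)
      qed
      then show ?thesis
        using q by (auto intro!: poly_module.span_scale[OF poly_module.span_base])
    qed
    then show "f \<in> ideal_gen (xpow ` set (F 0))"
      unfolding w(2) ideal_gen_def using index_mult_vec_sum[OF c0 w(1), of 0]
      by (auto intro!: poly_module.span_sum)
  qed
  then show ?thesis by (simp add: homological_shift_ideal_eq[OF m])
qed

section \<open>Ideals with linear quotients\<close>

definition sqf :: "'v::finite set \<Rightarrow> 'v expo"
  where "sqf A = Abs_poly_mapping (\<lambda>p. if p \<in> A then 1 else 0)"

lemma lookup_sqf [simp]: "lookup (sqf A) p = (if p \<in> A then 1 else 0)"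
  by (simp add: sqf_def)

lemma keys_sqf [simp]: "keys (sqf A) = A"
  by (auto simp: in_keys_iff split: if_splits)

lemma keys_add_expo: "keys (a + b :: 'v expo) = keys a \<union> keys b"
  by (auto simp: in_keys_iff lookup_add)

lemma ideal_gen_insert:
  "ideal_gen (insert a X) = {f + g * a |f g. f \<in> ideal_gen X}"
proof -
  have "(\<exists>k. x - k * a \<in> ideal_gen X) \<longleftrightarrow> (\<exists>f g. x = f + g * a \<and> f \<in> ideal_gen X)" for x
    by (metis add_diff_cancel_right' diff_add_cancel)
  then show ?thesis
    by (simp add: ideal_gen_def poly_module.span_insert)
qed

lemma min_graded_free_resolution_zero:
  "min_graded_free_resolution (\<lambda>_. []) (\<lambda>i. 0\<^sub>m (if i = 0 then 1 else 0) 0)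
    (ideal_gen {} :: ('v, 'k::field) mpoly set)"
proof -
  have carrier: "v \<in> carrier_vec 0 \<longleftrightarrow> v = 0\<^sub>v 0" for v :: "('v, 'k) mpoly vec"
    by (auto intro!: eq_vecI)
  have "0\<^sub>m l 0 *\<^sub>v 0\<^sub>v 0 = (0\<^sub>v l :: ('v, 'k) mpoly vec)" for l
    by (intro eq_vecI) auto
  then have im: "mat_image (0\<^sub>m l 0) = {0\<^sub>v l :: ('v, 'k) mpoly vec}"
    and ker: "mat_kernel (0\<^sub>m l 0) = {0\<^sub>v 0 :: ('v, 'k) mpoly vec}" for l
    by (auto simp: mat_image_def mat_kernel_def carrier)
  show ?thesis
    by (auto simp: min_graded_free_resolution_iff exact_complex_def graded_map_def im ker
        ideal_gen_def poly_module.span_empty)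
qed

text \<open>These are the degrees of the Koszul complex. A variable outside \<open>S\<close> is a
  nonzerodivisor modulo those in \<open>S\<close>, so the colon ideal is the ideal itself and the
  cone joins two copies of one resolution. The size is \<open>Suc k\<close> because the ideal is
  resolved and not the quotient ring.\<close>

lemma variables_resolution:
  fixes S :: "'v::finite set"
  shows "\<exists>F (d :: nat \<Rightarrow> ('v, 'k::field) mpoly mat). min_graded_free_resolution F d (ideal_gen (Var ` S)) \<and>
    (\<forall>k. set (F k) = {sqf A |A. A \<subseteq> S \<and> card A = Suc k})"
  using finite[of S]
proof (induction S rule: finite_induct)
  case empty
  have "\<exists>d :: nat \<Rightarrow> ('v, 'k) mpoly mat. min_graded_free_resolution (\<lambda>_. []) d (ideal_gen {})"
    using min_graded_free_resolution_zero by blast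
  then show ?case
    by (intro exI[of _ "\<lambda>_. []"]) auto
next
  case (insert p S)
  let ?I = "ideal_gen (Var ` S) :: ('v, 'k) mpoly set" and ?u = "Poly_Mapping.single p 1 :: 'v expo"
  obtain F d where F: "min_graded_free_resolution F d ?I"
    and degs: "\<And>k. set (F k) = {sqf A |A. A \<subseteq> S \<and> card A = Suc k}"
    using insert.IH by blast
  have Var: "Var ` S = (xpow ` (\<lambda>q. Poly_Mapping.single q 1) ` S :: ('v, 'k) mpoly set)"
    by (simp add: Var_def image_image)
  have "(\<exists>q\<in>S. edvd (Poly_Mapping.single q 1) (?u + m)) \<longleftrightarrow> (\<exists>q\<in>S. lookup m q \<noteq> 0)" for m
    using insert.hyps(2) by (auto simp: edvd_single[unfolded One_nat_def] lookup_add lookup_single when_def)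
  then have colon: "ideal_colon ?I (xpow ?u) = ?I"
    unfolding Var ideal_colon_xpow unfolding Var[symmetric] ideal_gen_Var by simp
  have u_sqf: "?u + sqf A = sqf (insert p A)" if "A \<subseteq> S" for A
    using that insert.hyps(2)
    by (intro poly_mapping_eqI) (auto simp: lookup_add lookup_single when_def)
  have disj: "(+) ?u ` set (F k) \<inter> set (F k) = {}" for k
  proof -
    have "?u + sqf A \<noteq> sqf B" if "A \<subseteq> S" "B \<subseteq> S" for A B
    proof
      assume "?u + sqf A = sqf B"
      then have "lookup (?u + sqf A) p = lookup (sqf B) p" by simp
      moreover have "p \<notin> B" using that insert.hyps(2) by blast
      ultimately show False by (simp add: lookup_add)
    qed
    then show ?thesis by (auto simp: degs)
  qed
  have "0 \<notin> set (F 0)"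
  proof
    assume "0 \<in> set (F 0)"
    then obtain A :: "'v set" where "0 = sqf A" "card A = Suc 0" by (auto simp: degs)
    then show False using keys_sqf[of A] by simp
  qed
  then obtain D where D: "min_graded_free_resolution
    (\<lambda>k. F k @ (case k of 0 \<Rightarrow> [?u] | Suc i \<Rightarrow> map ((+) ?u) (F i))) D {f + g * xpow ?u |f g. f \<in> ?I}"
    using min_graded_free_resolution_cone[OF F F colon disj] by blast
  have J: "{f + g * xpow ?u |f g. f \<in> ?I} = ideal_gen (Var ` insert p S)"
    unfolding image_insert ideal_gen_insert by (simp add: Var_def)
  \<comment> \<open>The new part in degree \<open>k\<close> comes from \<open>F (k - 1)\<close>,
    whose subsets have \<open>k\<close> elements; for \<open>k = 0\<close> the empty subset accounts
    for the generator \<open>?u\<close>.\<close>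
  have "set (case k of 0 \<Rightarrow> [?u] | Suc i \<Rightarrow> map ((+) ?u) (F i)) = {?u + sqf A |A. A \<subseteq> S \<and> card A = k}"
      for k
  proof (cases k)
    case 0
    have "?u + sqf {} = ?u" by (intro poly_mapping_eqI) (simp add: lookup_add)
    then have "{?u + sqf A |A. A \<subseteq> S \<and> card A = 0} = {?u}"
      using insert.hyps(1) by (auto intro!: exI[of _ "{}"])
    then show ?thesis using 0 by simp
  qed (auto simp: degs)
  moreover have "{?u + sqf A |A. A \<subseteq> S \<and> card A = k} = {sqf (insert p A) |A. A \<subseteq> S \<and> card A = k}" for k
    using u_sqf by (intro Collect_cong) metis
  moreover have "{sqf A |A. A \<subseteq> S \<and> card A = Suc k} \<union> {sqf (insert p A) |A. A \<subseteq> S \<and> card A = k} =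
      {sqf A |A. A \<subseteq> insert p S \<and> card A = Suc k}" for k
  proof (intro equalityI subsetI)
    fix a assume "a \<in> {sqf A |A. A \<subseteq> S \<and> card A = Suc k} \<union> {sqf (insert p A) |A. A \<subseteq> S \<and> card A = k}"
    then consider A where "a = sqf A" "A \<subseteq> S" "card A = Suc k"
      | A where "a = sqf (insert p A)" "A \<subseteq> S" "card A = k" by auto
    then show "a \<in> {sqf A |A. A \<subseteq> insert p S \<and> card A = Suc k}"
    proof cases
      case 2
      then have "card (insert p A) = Suc k" using insert.hyps(2) by (subst card_insert_disjoint) auto
      then show ?thesis using 2 by blast
    qed blast
  next
    fix a assume "a \<in> {sqf A |A. A \<subseteq> insert p S \<and> card A = Suc k}"
    then obtain A where A: "a = sqf A" "A \<subseteq> insert p S" "card A = Suc k" by blast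
    show "a \<in> {sqf A |A. A \<subseteq> S \<and> card A = Suc k} \<union> {sqf (insert p A) |A. A \<subseteq> S \<and> card A = k}"
    proof (cases "p \<in> A")
      case True
      define B where "B = A - {p}"
      have "a = sqf (insert p B)" using A(1) True by (simp add: B_def insert_absorb)
      moreover have "B \<subseteq> S" "card B = k" using A True by (auto simp: B_def)
      ultimately show ?thesis by blast
    qed (use A in blast)
  qed
  ultimately have "set (F k @ (case k of 0 \<Rightarrow> [?u] | Suc i \<Rightarrow> map ((+) ?u) (F i))) =
      {sqf A |A. A \<subseteq> insert p S \<and> card A = Suc k}" for k
    by (simp only: set_append degs)
  then show ?case
    using D unfolding J by (intro exI conjI allI)
qed

section \<open>Linear quotients as a condition on exponent vectors\<close>

text \<open>The variables contained in the colon ideal. If variables generate that ideal at all,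
  then these do, so they can replace an unknown set \<open>S\<close>.\<close>

definition colon_vars :: "'v expo \<Rightarrow> 'v expo set \<Rightarrow> 'v set"
  where "colon_vars v W = {p. \<exists>l \<in> W. edvd l (v + Poly_Mapping.single p 1)}"

text \<open>The colon ideal is generated by the monomials \<open>u / gcd(u, v)\<close>, and the
  hypothesis makes each of them divisible by a variable that already lies in it.\<close>

lemma ideal_colon_eq_colon_vars:
  assumes *: "\<forall>u \<in> W. \<exists>p \<in> colon_vars v W. lookup v p < lookup u p"
  shows "ideal_colon (ideal_gen (xpow ` W)) (xpow v) =
      (ideal_gen (Var ` colon_vars v W) :: ('v, 'k::field) mpoly set)"
proof -
  have "(\<exists>u \<in> W. edvd u (v + m)) \<longleftrightarrow> (\<exists>p \<in> colon_vars v W. lookup m p \<noteq> 0)" for m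
  proof
    assume "\<exists>u \<in> W. edvd u (v + m)"
    then obtain u where u: "u \<in> W" "edvd u (v + m)" by blast
    then obtain p where p: "p \<in> colon_vars v W" "lookup v p < lookup u p" using * by blast
    have "lookup u p \<le> lookup v p + lookup m p" using u(2) by (simp add: edvd_def lookup_add)
    then show "\<exists>p \<in> colon_vars v W. lookup m p \<noteq> 0" using p by (intro bexI[of _ p]) auto
  next
    assume "\<exists>p \<in> colon_vars v W. lookup m p \<noteq> 0"
    then obtain p l where p: "lookup m p \<noteq> 0" "l \<in> W" "edvd l (v + Poly_Mapping.single p 1)"
      by (auto simp: colon_vars_def)
    have "edvd (v + Poly_Mapping.single p 1) (v + m)"
      using p(1) edvd_single[of p m] by (auto simp: edvd_def lookup_add)
    then show "\<exists>u \<in> W. edvd u (v + m)" using p edvd_trans by blast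
  qed
  then show ?thesis
    by (simp add: ideal_colon_xpow ideal_gen_Var)
qed

lemma ideal_colon_eq_Var_iff:
  "(\<exists>S. ideal_colon (ideal_gen (xpow ` W)) (xpow v) =
      (ideal_gen (Var ` S) :: ('v, 'k::field) mpoly set)) \<longleftrightarrow>
    (\<forall>u \<in> W. \<exists>p \<in> colon_vars v W. lookup v p < lookup u p)"
proof
  assume "\<exists>S. ideal_colon (ideal_gen (xpow ` W)) (xpow v) = (ideal_gen (Var ` S) :: ('v, 'k) mpoly set)"
  then obtain S where S: "ideal_colon (ideal_gen (xpow ` W)) (xpow v) =
      (ideal_gen (Var ` S) :: ('v, 'k) mpoly set)" ..
  have iff: "(\<exists>u \<in> W. edvd u (v + m)) \<longleftrightarrow> (\<exists>p \<in> S. lookup m p \<noteq> 0)" for m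
  proof -
    have "(xpow m :: ('v, 'k) mpoly) \<in> ideal_colon (ideal_gen (xpow ` W)) (xpow v) \<longleftrightarrow>
        xpow m \<in> (ideal_gen (Var ` S) :: ('v, 'k) mpoly set)"
      by (simp only: S)
    then show ?thesis
      by (simp add: ideal_colon_xpow ideal_gen_Var) (simp add: xpow_def)
  qed
  show "\<forall>u \<in> W. \<exists>p \<in> colon_vars v W. lookup v p < lookup u p"
  proof
    fix u assume u: "u \<in> W"
    \<comment> \<open>Truncated subtraction makes \<open>u - v\<close> the exponent of
      \<open>u / gcd(u, v)\<close>, which belongs to the colon ideal and so involves a variable of
      \<open>S\<close>.\<close>
    have "edvd u (v + (u - v))"
      by (auto simp: edvd_def lookup_add lookup_minus)
    then obtain p where p: "p \<in> S" "lookup (u - v) p \<noteq> 0" using iff u by blast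
    have "lookup (Poly_Mapping.single p (1::nat)) p \<noteq> 0" by simp
    then have "p \<in> colon_vars v W"
      using iff[of "Poly_Mapping.single p 1"] p(1) unfolding colon_vars_def by blast
    then show "\<exists>p \<in> colon_vars v W. lookup v p < lookup u p"
      using p(2) by (intro bexI[of _ p]) (auto simp: lookup_minus)
  qed
qed (metis ideal_colon_eq_colon_vars)

text \<open>The list is in reverse order: the head is the last generator.\<close>

fun lin_quot :: "'v expo list \<Rightarrow> bool"
  where "lin_quot [] \<longleftrightarrow> True"
  | "lin_quot (v # vs) \<longleftrightarrow>
      lin_quot vs \<and> (\<forall>u \<in> set vs. \<exists>p \<in> colon_vars v (set vs). lookup v p < lookup u p)"

fun shifts :: "nat \<Rightarrow> 'v::finite expo list \<Rightarrow> 'v expo set"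
  where "shifts k [] = {}"
  | "shifts k (v # vs) = shifts k vs \<union> {v + sqf A |A. A \<subseteq> colon_vars v (set vs) \<and> card A = k}"

text \<open>Under this disjointness multiplication by \<open>sqf A\<close> adds exactly
  \<open>card A\<close> elements to the support, so the degrees in \<open>shifts k\<close> have
  supports of one size if the generators do.\<close>

fun supp_free :: "'v expo list \<Rightarrow> bool"
  where "supp_free [] \<longleftrightarrow> True"
  | "supp_free (v # vs) \<longleftrightarrow> supp_free vs \<and> colon_vars v (set vs) \<inter> keys v = {}"

lemma card_keys_shifts:
  fixes vs :: "'v::finite expo list"
  assumes "supp_free vs" "\<forall>v \<in> set vs. card (keys v) = n" "a \<in> shifts k vs"
  shows "card (keys a) = n + k"
  using assms
proof (induction vs)
  case (Cons v vs)
  show ?case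
  proof (cases "a \<in> shifts k vs")
    case False
    then obtain A where A: "a = v + sqf A" "A \<subseteq> colon_vars v (set vs)" "card A = k"
      using Cons.prems(3) by auto
    then have "keys v \<inter> A = {}" using Cons.prems(1) by auto
    then show ?thesis
      using A Cons.prems(2) by (simp add: keys_add_expo card_Un_disjoint)
  qed (use Cons in auto)
qed simp

theorem linear_quotients_resolution:
  fixes vs :: "'v::finite expo list"
  assumes "lin_quot vs" "supp_free vs" "\<forall>v \<in> set vs. card (keys v) = n"
  shows "\<exists>F (d :: nat \<Rightarrow> ('v, 'k::field) mpoly mat).
    min_graded_free_resolution F d (ideal_gen (xpow ` set vs)) \<and> (\<forall>k. set (F k) = shifts k vs)"
  using assms
proof (induction vs)
  case Nil
  have "\<exists>d :: nat \<Rightarrow> ('v, 'k) mpoly mat. min_graded_free_resolution (\<lambda>_. []) d (ideal_gen {})"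
    using min_graded_free_resolution_zero by blast
  then show ?case
    by (intro exI[of _ "\<lambda>_. []"]) auto
next
  case (Cons v vs)
  let ?S = "colon_vars v (set vs)" and ?I = "ideal_gen (xpow ` set vs) :: ('v, 'k) mpoly set"
  obtain F d where F: "min_graded_free_resolution F d ?I" and degF: "\<And>k. set (F k) = shifts k vs"
    using Cons by auto
  obtain G and e :: "nat \<Rightarrow> ('v, 'k) mpoly mat"
      where G: "min_graded_free_resolution G e (ideal_gen (Var ` ?S))"
    and degG: "\<And>k. set (G k) = {sqf A |A. A \<subseteq> ?S \<and> card A = Suc k}"
    using variables_resolution[of ?S] by blast
  have colon: "ideal_colon ?I (xpow v) = ideal_gen (Var ` ?S)"
    using Cons.prems(1) by (intro ideal_colon_eq_colon_vars) simp
  \<comment> \<open>The subsets in \<open>G k\<close> have \<open>Suc k\<close> elements, so after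
    the shift by \<open>v\<close> the supports have size \<open>n + k + 1\<close>, against
    \<open>n + k\<close> in \<open>F k\<close>.\<close>
  have disj: "(+) v ` set (G k) \<inter> set (F k) = {}" for k
  proof -
    have "v + sqf A \<notin> shifts k vs" if "A \<subseteq> ?S" "card A = Suc k" for A
    proof
      assume "v + sqf A \<in> shifts k vs"
      then have "card (keys (v + sqf A)) = n + k"
        using Cons.prems by (intro card_keys_shifts[of vs]) auto
      moreover have "keys v \<inter> A = {}" using Cons.prems(2) that by auto
      then have "card (keys (v + sqf A)) = n + Suc k"
        using Cons.prems(3) that by (simp add: keys_add_expo card_Un_disjoint)
      ultimately show False by simp
    qed
    then show ?thesis by (auto simp: degF degG)
  qed
  have "0 \<notin> set (G 0)"
  proof
    assume "0 \<in> set (G 0)"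
    then obtain A :: "'v set" where "0 = sqf A" "card A = Suc 0" by (auto simp: degG)
    then show False using keys_sqf[of A] by simp
  qed
  then obtain D where D: "min_graded_free_resolution
    (\<lambda>k. F k @ (case k of 0 \<Rightarrow> [v] | Suc i \<Rightarrow> map ((+) v) (G i))) D {f + g * xpow v |f g. f \<in> ?I}"
    using min_graded_free_resolution_cone[OF F G colon disj] by blast
  have J: "{f + g * xpow v |f g. f \<in> ?I} = ideal_gen (xpow ` set (v # vs))"
    unfolding list.set(2) image_insert ideal_gen_insert ..
  have "set (case k of 0 \<Rightarrow> [v] | Suc i \<Rightarrow> map ((+) v) (G i)) = {v + sqf A |A. A \<subseteq> ?S \<and> card A = k}" for k
  proof (cases k)
    case 0
    have "v + sqf {} = v" by (intro poly_mapping_eqI) (simp add: lookup_add)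
    then have "{v + sqf A |A. A \<subseteq> ?S \<and> card A = 0} = {v}"
      by (auto intro!: exI[of _ "{}"])
    then show ?thesis using 0 by simp
  qed (auto simp: degG)
  then have "set (F k @ (case k of 0 \<Rightarrow> [v] | Suc i \<Rightarrow> map ((+) v) (G i))) = shifts k (v # vs)" for k
    by (simp only: set_append degF shifts.simps)
  then show ?case
    using D unfolding J by (intro exI conjI allI)
qed

lemma lin_quot_rev_iff:
  "lin_quot (rev ws) \<longleftrightarrow> (\<forall>i < length ws. \<forall>u \<in> set (take i ws).
    \<exists>p \<in> colon_vars (ws ! i) (set (take i ws)). lookup (ws ! i) p < lookup u p)"
proof (induction ws rule: rev_induct)
  case (snoc w ws)
  have "(\<forall>i < length (ws @ [w]). P (take i (ws @ [w])) ((ws @ [w]) ! i)) \<longleftrightarrow>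
      (\<forall>i < length ws. P (take i ws) (ws ! i)) \<and> P ws w" for P
    by (auto simp: less_Suc_eq nth_append)
  from this[of "\<lambda>W v. \<forall>u \<in> set W. \<exists>p \<in> colon_vars v (set W). lookup v p < lookup u p"]
  show ?case using snoc by simp
qed simp

lemma xpow_eq_iff [simp]: "(xpow a :: ('v, 'k::field) mpoly) = xpow b \<longleftrightarrow> a = b"
  by (metis keys_single singleton_inject xpow_def zero_neq_one)

text \<open>Monomial generators come from a list of exponent vectors, reversed because
  \<open>lin_quot\<close> recurses from the last generator. The restriction \<open>0 < i\<close>
  disappears, since at \<open>i = 0\<close> there are no earlier generators.\<close>

lemma linear_quotients_iff:
  fixes J :: "('v, 'k::field) mpoly set"
  shows "linear_quotients J \<longleftrightarrow> (\<exists>vs. distinct vs \<and> min_monomial_gens (xpow ` set vs) J \<and> lin_quot vs)"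
proof -
  have *: "(\<forall>i. 0 < i \<and> i < length (map xpow ws :: ('v, 'k) mpoly list) \<longrightarrow>
      (\<exists>S. ideal_colon (ideal_gen (set (take i (map xpow ws)))) (map xpow ws ! i) =
        (ideal_gen (Var ` S) :: ('v, 'k) mpoly set))) \<longleftrightarrow> lin_quot (rev ws)" for ws :: "'v expo list"
  proof -
    have "(\<exists>S. ideal_colon (ideal_gen (set (take i (map xpow ws)))) (map xpow ws ! i) =
        (ideal_gen (Var ` S) :: ('v, 'k) mpoly set)) \<longleftrightarrow>
        (\<forall>u \<in> set (take i ws). \<exists>p \<in> colon_vars (ws ! i) (set (take i ws)). lookup (ws ! i) p < lookup u p)"
      if "i < length ws" for i
      using that by (simp add: take_map ideal_colon_eq_Var_iff)
    then show ?thesis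
      unfolding lin_quot_rev_iff by (metis length_map neq0_conv take_0 empty_iff list.set(1))
  qed
  show ?thesis
  proof
    assume "linear_quotients J"
    then obtain us where us: "distinct us" "min_monomial_gens (set us) J"
      "\<forall>i. 0 < i \<and> i < length us \<longrightarrow>
        (\<exists>S. ideal_colon (ideal_gen (set (take i us))) (us ! i) = ideal_gen (Var ` S))"
      unfolding linear_quotients_def by blast
    have "set us \<subseteq> range xpow" using us(2) by (simp add: min_monomial_gens_def)
    then obtain ws where ws: "us = map xpow ws"
      by (metis ex_map_conv subsetD rangeE)
    then show "\<exists>vs. distinct vs \<and> min_monomial_gens (xpow ` set vs) J \<and> lin_quot vs"
      using us * by (intro exI[of _ "rev ws"]) (auto simp: distinct_map)
  next
    assume "\<exists>vs. distinct vs \<and> min_monomial_gens (xpow ` set vs) J \<and> lin_quot vs"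
    then obtain vs where vs: "distinct vs" "min_monomial_gens (xpow ` set vs) J" "lin_quot vs" by blast
    then show "linear_quotients J"
      unfolding linear_quotients_def using *[of "rev vs"]
      by (intro exI[of _ "map xpow (rev vs)"]) (auto simp: distinct_map inj_on_def)
  qed
qed

section \<open>Minimal monomial generators\<close>

lemma ideal_gen_xpow_eqI:
  assumes "\<And>v. v \<in> V \<Longrightarrow> \<exists>u \<in> U. edvd u v" "\<And>u. u \<in> U \<Longrightarrow> \<exists>v \<in> V. edvd v u"
  shows "ideal_gen (xpow ` V) = (ideal_gen (xpow ` U) :: ('v, 'k::field) mpoly set)"
  unfolding ideal_gen_xpow using assms edvd_trans by (intro Collect_cong) blast

lemma ideal_gen_xpow_eqD:
  assumes "ideal_gen (xpow ` V) = (ideal_gen (xpow ` U) :: ('v, 'k::field) mpoly set)" "v \<in> V"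
  obtains u where "u \<in> U" "edvd u v"
  using assms xpow_in_ideal_gen[of v V, where 'k = 'k]
    xpow_in_ideal_gen[of v U, where 'k = 'k] edvd_refl
  by blast

text \<open>Each \<open>v\<close> is divisible by some \<open>u\<close> in \<open>U\<close>, and
  \<open>u\<close> by some \<open>v'\<close> in \<open>V\<close>. If \<open>v'\<close> differed from
  \<open>v\<close>, then \<open>v\<close> would be redundant; so \<open>v' = v\<close>, and
  antisymmetry gives \<open>u = v\<close>. Linear quotient orders therefore list given monomials
  only.\<close>

lemma min_monomial_gens_subset:
  assumes min: "min_monomial_gens (xpow ` V) (ideal_gen (xpow ` U) :: ('v, 'k::field) mpoly set)"
  shows "V \<subseteq> U"
proof
  fix v assume v: "v \<in> V"
  have eq: "ideal_gen (xpow ` V) = (ideal_gen (xpow ` U) :: ('v, 'k) mpoly set)"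
    using min by (simp add: min_monomial_gens_def)
  obtain u where u: "u \<in> U" "edvd u v" using ideal_gen_xpow_eqD[OF eq v] .
  obtain v' where v': "v' \<in> V" "edvd v' u" using ideal_gen_xpow_eqD[OF eq[symmetric] u(1)] .
  have "v' = v"
  proof (rule ccontr)
    assume ne: "v' \<noteq> v"
    have "ideal_gen (xpow ` (V - {v})) = (ideal_gen (xpow ` V) :: ('v, 'k) mpoly set)"
    proof (rule ideal_gen_xpow_eqI)
      show "\<exists>x \<in> V. edvd x y" if "y \<in> V - {v}" for y
        using that edvd_refl by blast
      show "\<exists>x \<in> V - {v}. edvd x y" if "y \<in> V" for y
        using that edvd_refl edvd_trans[OF v'(2) u(2)] v'(1) ne by (cases "y = v") blast+
    qed
    moreover have "xpow ` (V - {v}) \<subset> (xpow ` V :: ('v, 'k) mpoly set)"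
    proof -
      have "xpow v \<notin> (xpow ` (V - {v}) :: ('v, 'k) mpoly set)" by auto
      then show ?thesis using v by blast
    qed
    ultimately show False
      using min eq by (auto simp: min_monomial_gens_def)
  qed
  then show "v \<in> U" using u v' edvd_antisym by blast
qed

lemma min_monomial_gens_xpow_antichain:
  assumes "\<And>u v. u \<in> V \<Longrightarrow> v \<in> V \<Longrightarrow> edvd u v \<Longrightarrow> u = v"
  shows "min_monomial_gens (xpow ` V) (ideal_gen (xpow ` V) :: ('v, 'k::field) mpoly set)"
  unfolding min_monomial_gens_def
proof (intro conjI allI impI)
  fix B :: "('v, 'k) mpoly set" assume B: "B \<subset> xpow ` V"
  then obtain v where v: "v \<in> V" "xpow v \<notin> B" by blast
  have BW: "B = xpow ` {w \<in> V. xpow w \<in> B}" using B by blast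
  show "ideal_gen B \<noteq> ideal_gen (xpow ` V)"
  proof
    assume "ideal_gen B = ideal_gen (xpow ` V)"
    then have "ideal_gen (xpow ` V) = (ideal_gen (xpow ` {w \<in> V. xpow w \<in> B}) :: ('v, 'k) mpoly set)"
      using BW by simp
    then obtain w where "w \<in> {w \<in> V. (xpow w :: ('v, 'k) mpoly) \<in> B}" "edvd w v"
      using v(1) by (rule ideal_gen_xpow_eqD)
    then show False using assms v by blast
  qed
qed auto

section \<open>Radicals of monomials\<close>

definition rad :: "'v::finite expo \<Rightarrow> 'v expo"
  where "rad a = sqf (keys a)"

lemma keys_rad [simp]: "keys (rad a) = keys a"
  by (simp add: rad_def)

lemma rad_eq_iff: "rad a = rad b \<longleftrightarrow> keys a = keys b"
  by (metis keys_rad rad_def)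

lemma edvd_rad_iff: "edvd (rad a) b \<longleftrightarrow> keys a \<subseteq> keys b"
  by (auto simp: edvd_def rad_def in_keys_iff subset_iff Suc_le_eq)

lemma colon_vars_not_in_keys:
  fixes v :: "'v::finite expo"
  assumes "\<And>l. l \<in> W \<Longrightarrow> card (keys l) = card (keys v)" "\<And>l. l \<in> W \<Longrightarrow> keys l \<noteq> keys v"
  shows "colon_vars v W \<inter> keys v = {}"
proof (rule ccontr)
  assume "colon_vars v W \<inter> keys v \<noteq> {}"
  then obtain p l where p: "p \<in> keys v" "l \<in> W" "edvd l (v + Poly_Mapping.single p 1)"
    by (auto simp: colon_vars_def)
  then have "keys l \<subseteq> keys v"
    using edvd_keys_mono[OF p(3)] by (auto simp: keys_add_expo)
  then show False using assms p(2) card_subset_eq[of "keys v" "keys l"] by auto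
qed

text \<open>Let \<open>l\<close> be an earlier generator supported in
  \<open>insert p (keys v)\<close>. The variable that linear quotients provide for \<open>l\<close>
  divides \<open>l\<close> but not \<open>v\<close>, hence it is \<open>p\<close>. So the supports
  alone decide which variables lie in the colon ideal.\<close>

lemma colon_vars_rad:
  fixes v :: "'v::finite expo"
  assumes card: "\<And>l. l \<in> W \<Longrightarrow> card (keys l) = card (keys v)" and ne: "\<And>l. l \<in> W \<Longrightarrow> keys l \<noteq> keys v"
    and lq: "\<forall>u \<in> W. \<exists>p \<in> colon_vars v W. lookup v p < lookup u p"
  shows "colon_vars (rad v) (rad ` W) = colon_vars v W"
proof -
  note free = colon_vars_not_in_keys[OF card ne]
  have "p \<in> colon_vars (rad v) (rad ` W) \<longleftrightarrow> (\<exists>l \<in> W. keys l \<subseteq> insert p (keys v))" for p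
    by (simp add: colon_vars_def edvd_rad_iff keys_add_expo)
  moreover have "(\<exists>l \<in> W. keys l \<subseteq> insert p (keys v)) \<longleftrightarrow> p \<in> colon_vars v W" for p
  proof
    assume "\<exists>l \<in> W. keys l \<subseteq> insert p (keys v)"
    then obtain l where l: "l \<in> W" "keys l \<subseteq> insert p (keys v)" by blast
    then obtain q where q: "q \<in> colon_vars v W" "lookup v q < lookup l q" using lq by blast
    then have "q \<in> keys l" by (simp add: in_keys_iff)
    then have "q = p" using q(1) free l(2) by blast
    then show "p \<in> colon_vars v W" using q(1) by simp
  next
    assume "p \<in> colon_vars v W"
    then obtain l where l: "l \<in> W" "edvd l (v + Poly_Mapping.single p 1)" by (auto simp: colon_vars_def)
    then show "\<exists>l \<in> W. keys l \<subseteq> insert p (keys v)"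
      using edvd_keys_mono[OF l(2)] by (intro bexI[of _ l]) (auto simp: keys_add_expo)
  qed
  ultimately show ?thesis by blast
qed

text \<open>\<open>remdups\<close> keeps last occurrences, and lists run from the last generator to
  the first, so the earliest generator with a given radical survives. All supports before it differ
  from its own; its colon variables are therefore preserved, whatever repetitions occur among the
  earlier radicals.\<close>

lemma lin_quot_remdups_rad:
  fixes vs :: "'v::finite expo list"
  assumes "lin_quot vs" "\<forall>v \<in> set vs. card (keys v) = n"
  shows "lin_quot (remdups (map rad vs))"
  using assms
proof (induction vs)
  case (Cons v vs)
  show ?case
  proof (cases "rad v \<in> rad ` set vs")
    case False
    have card: "card (keys l) = card (keys v)" and ne: "keys l \<noteq> keys v" if "l \<in> set vs" for l
      using that Cons.prems(2) False by (auto simp: rad_eq_iff image_iff)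
    have free: "colon_vars v (set vs) \<inter> keys v = {}"
      using card ne by (rule colon_vars_not_in_keys)
    have eq: "colon_vars (rad v) (rad ` set vs) = colon_vars v (set vs)"
      using card ne Cons.prems(1) by (intro colon_vars_rad) auto
    have "\<exists>p \<in> colon_vars v (set vs). lookup (rad v) p < lookup (rad u) p" if u: "u \<in> set vs" for u
    proof -
      obtain p where p: "p \<in> colon_vars v (set vs)" "lookup v p < lookup u p"
        using Cons.prems(1) u by auto
      then have "p \<notin> keys v" "p \<in> keys u" using free by (auto simp: in_keys_iff)
      then show ?thesis using p(1) by (intro bexI[of _ p]) (simp_all add: rad_def)
    qed
    then show ?thesis using Cons False by (simp add: eq)
  qed (use Cons in auto)
qed simp

lemma supp_free_if_distinct:
  fixes vs :: "'v::finite expo list"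
  assumes "distinct (map rad vs)" "\<forall>v \<in> set vs. card (keys v) = n"
  shows "supp_free vs"
  using assms
proof (induction vs)
  case (Cons v vs)
  have "colon_vars v (set vs) \<inter> keys v = {}"
    using Cons.prems by (intro colon_vars_not_in_keys) (auto simp: rad_eq_iff image_iff)
  then show ?case using Cons by auto
qed simp

text \<open>The admissible sets \<open>A\<close> agree on both sides, and as \<open>A\<close> avoids
  the support of \<open>v\<close>, \<open>rad (v + sqf A) = rad v + sqf A\<close>.\<close>

lemma shifts_rad:
  fixes vs :: "'v::finite expo list"
  assumes "lin_quot vs" "distinct (map rad vs)" "\<forall>v \<in> set vs. card (keys v) = n"
  shows "shifts k (map rad vs) = rad ` shifts k vs"
  using assms
proof (induction vs)
  case (Cons v vs)
  have card: "card (keys l) = card (keys v)" and ne: "keys l \<noteq> keys v" if "l \<in> set vs" for l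
    using that Cons.prems(2,3) by (auto simp: rad_eq_iff image_iff)
  have free: "colon_vars v (set vs) \<inter> keys v = {}"
    using card ne by (rule colon_vars_not_in_keys)
  have eq: "colon_vars (rad v) (rad ` set vs) = colon_vars v (set vs)"
    using card ne Cons.prems(1) by (intro colon_vars_rad) auto
  have "rad v + sqf A = rad (v + sqf A)" if "A \<subseteq> colon_vars v (set vs)" for A
    using that free by (intro poly_mapping_eqI) (auto simp: rad_def keys_add_expo lookup_add)
  then have "{rad v + sqf A |A. A \<subseteq> colon_vars v (set vs) \<and> card A = k} =
      rad ` {v + sqf A |A. A \<subseteq> colon_vars v (set vs) \<and> card A = k}"
    by (auto simp: image_iff) metis+
  then show ?case using Cons by (simp add: eq image_Un)
qed simp

text \<open>\<open>W\<close> may contain redundant degrees. A minimal generator dividing one has the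
  same support, by equal size, and so the same radical; the radicals of the minimal generators thus
  exhaust the image of \<open>W\<close> under \<open>rad\<close>. This image is an antichain, hence
  a minimal generating set.\<close>

lemma linear_quotients_rad:
  fixes W :: "'v::finite expo set"
  assumes card: "\<forall>v \<in> W. card (keys v) = n"
    and lq: "linear_quotients (ideal_gen (xpow ` W) :: ('v, 'k::field) mpoly set)"
  shows "linear_quotients (ideal_gen (xpow ` rad ` W) :: ('v, 'k) mpoly set)"
proof -
  obtain vs where vs: "min_monomial_gens (xpow ` set vs)
      (ideal_gen (xpow ` W) :: ('v, 'k) mpoly set)" "lin_quot vs"
    using lq unfolding linear_quotients_iff by blast
  have sub: "set vs \<subseteq> W" using min_monomial_gens_subset[OF vs(1)] .
  have eq: "ideal_gen (xpow ` W) = (ideal_gen (xpow ` set vs) :: ('v, 'k) mpoly set)"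
    using vs(1) by (simp add: min_monomial_gens_def)
  have "rad w \<in> rad ` set vs" if w: "w \<in> W" for w
  proof -
    obtain v where v: "v \<in> set vs" "edvd v w" using ideal_gen_xpow_eqD[OF eq w] .
    then have "keys v = keys w"
      using card w sub edvd_keys_mono[OF v(2)] by (intro card_subset_eq) auto
    then show ?thesis using v(1) by (metis imageI rad_eq_iff)
  qed
  then have rad: "set (remdups (map rad vs)) = rad ` W" using sub by auto
  have "u = v" if uv: "u \<in> rad ` W" "v \<in> rad ` W" "edvd u v" for u v
  proof -
    obtain a b where ab: "u = rad a" "v = rad b" "a \<in> W" "b \<in> W" using uv by blast
    then have "keys a = keys b"
      using card edvd_keys_mono[OF uv(3)] by (intro card_subset_eq) auto
    then show ?thesis using ab by (simp add: rad_eq_iff)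
  qed
  then have "min_monomial_gens (xpow ` rad ` W) (ideal_gen (xpow ` rad ` W) :: ('v, 'k) mpoly set)"
    by (rule min_monomial_gens_xpow_antichain)
  moreover have "lin_quot (remdups (map rad vs))"
    using vs(2) sub card by (intro lin_quot_remdups_rad) auto
  ultimately show ?thesis
    unfolding linear_quotients_iff using rad by (intro exI[of _ "remdups (map rad vs)"]) auto
qed

text \<open>Injectivity of \<open>rad\<close> makes divisibility within \<open>U\<close> trivial, so
  a linear quotient order lists all of \<open>U\<close> and has distinct radicals. Both resolutions
  are then explicit, and \<open>linear_quotients_rad\<close> applies in each homological degree, to
  supports of size \<open>n + k\<close>.\<close>

theorem homological_linear_quotients_rad:
  fixes U :: "'v::finite expo set"
  assumes fin: "finite U" and card: "\<forall>u \<in> U. card (keys u) = n" and inj: "inj_on rad U"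
    and hlq: "homological_linear_quotients (ideal_gen (xpow ` U) :: ('v, 'k::field) mpoly set)"
  shows "homological_linear_quotients (ideal_gen (xpow ` rad ` U) :: ('v, 'k) mpoly set)"
proof -
  let ?J = "ideal_gen (xpow ` U) :: ('v, 'k) mpoly set"
  \<comment> \<open>The case \<open>k = 0\<close> of the hypothesis supplies the order from which
    all shift ideals are computed.\<close>
  have "linear_quotients ?J"
    using hlq homological_shift_ideal_0[OF fin, where 'k = 'k]
    unfolding homological_linear_quotients_def by metis
  then obtain vs where vs: "distinct vs" "min_monomial_gens (xpow ` set vs) ?J" "lin_quot vs"
    unfolding linear_quotients_iff by blast
  have sub: "set vs \<subseteq> U" using min_monomial_gens_subset[OF vs(2)] .
  have eq: "ideal_gen (xpow ` set vs) = ?J" using vs(2) by (simp add: min_monomial_gens_def)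
  have "U \<subseteq> set vs"
  proof
    fix u assume u: "u \<in> U"
    obtain v where v: "v \<in> set vs" "edvd v u" using ideal_gen_xpow_eqD[OF eq[symmetric] u] .
    then have "keys v = keys u"
      using card u sub edvd_keys_mono[OF v(2)] by (intro card_subset_eq) auto
    then have "v = u" using inj u v(1) sub by (metis inj_onD rad_eq_iff subsetD)
    then show "u \<in> set vs" using v(1) by simp
  qed
  then have U: "set vs = U" using sub by blast
  have d: "distinct (map rad vs)" using vs(1) inj U by (simp add: distinct_map)
  have cvs: "\<forall>v \<in> set vs. card (keys v) = n" using U card by simp
  have free: "supp_free vs" using d cvs by (rule supp_free_if_distinct)
  obtain F and d1 :: "nat \<Rightarrow> ('v, 'k) mpoly mat" where "min_graded_free_resolution F d1
      (ideal_gen (xpow ` set vs))"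
    "\<forall>k. set (F k) = shifts k vs"
    using linear_quotients_resolution[OF vs(3) free cvs] by blast
  then have HS: "homological_shift_ideal k ?J = ideal_gen (xpow ` shifts k vs)" for k
    using homological_shift_ideal_eq U by metis
  have crad: "\<forall>v \<in> set (map rad vs). card (keys v) = n" using cvs by simp
  have "rad (rad v) = rad v" for v :: "'v expo" by (simp add: rad_eq_iff)
  then have "map rad (map rad vs) = map rad vs" by simp
  with d have "distinct (map rad (map rad vs))" by (simp only:)
  then have frad: "supp_free (map rad vs)"
    using crad by (rule supp_free_if_distinct)
  have "lin_quot (map rad vs)"
    using lin_quot_remdups_rad[OF vs(3) cvs] d by (simp add: distinct_remdups_id)
  then obtain G and d2 :: "nat \<Rightarrow> ('v, 'k) mpoly mat" where
    "min_graded_free_resolution G d2 (ideal_gen (xpow ` set (map rad vs)))"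
    "\<forall>k. set (G k) = shifts k (map rad vs)"
    using linear_quotients_resolution[OF _ frad crad] by blast
  then have "homological_shift_ideal k (ideal_gen (xpow ` rad ` U)) =
      (ideal_gen (xpow ` rad ` shifts k vs) :: ('v, 'k) mpoly set)" for k
    using homological_shift_ideal_eq U shifts_rad[OF vs(3) d cvs] by (metis list.set_map)
  moreover have "linear_quotients (ideal_gen (xpow ` rad ` shifts k vs) :: ('v, 'k) mpoly set)" for k
  proof (rule linear_quotients_rad)
    show "\<forall>v \<in> shifts k vs. card (keys v) = n + k" using card_keys_shifts[OF free cvs] by blast
    show "linear_quotients (ideal_gen (xpow ` shifts k vs) :: ('v, 'k) mpoly set)"
      using hlq HS unfolding homological_linear_quotients_def by metis
  qed
  ultimately show ?thesis
    unfolding homological_linear_quotients_def by simp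
qed

section \<open>Edge ideals of weighted oriented graphs\<close>

lemma xpow_add: "xpow (a + b) = (xpow a * xpow b :: ('v, 'k::field) mpoly)"
  by (simp add: xpow_def mult_single)

lemma Var_power: "(Var x ^ k :: ('v, 'k::field) mpoly) = xpow (Poly_Mapping.single x k)"
proof (induction k)
  case (Suc k)
  have "Poly_Mapping.single x (Suc k) = Poly_Mapping.single x 1 + Poly_Mapping.single x k"
    by (simp flip: single_add)
  then show ?case using Suc by (simp add: Var_def xpow_add)
qed (simp add: xpow_def)

theorem corollary4p8:
  fixes E :: "('v::finite \<times> 'v) set" and w :: "'v \<Rightarrow> nat"
  assumes "weighted_oriented_graph E w"
    and "homological_linear_quotients (oriented_edge_ideal E w :: ('v, 'k::field) mpoly set)"
  shows "homological_linear_quotients (edge_ideal (underlying_graph E) :: ('v, 'k) mpoly set)"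
proof -
  have no_loop: "(x, x) \<notin> E" and asym: "(x, y) \<in> E \<Longrightarrow> (y, x) \<notin> E" and w: "w x \<noteq> 0" for x y
    using assms(1) unfolding weighted_oriented_graph_def by (force, blast, metis not_one_le_zero)
  define e where "e = (\<lambda>(x, y). Poly_Mapping.single x 1 + Poly_Mapping.single y (w y))"
  \<comment> \<open>Positive weights keep the head of each edge in the support.\<close>
  have keys_e: "keys (e (x, y)) = {x, y}" for x y
    by (auto simp: e_def keys_add_expo w)
  have "{Var x * Var y ^ w y |x y. (x, y) \<in> E} = (xpow ` e ` E :: ('v, 'k) mpoly set)"
    unfolding Var_power by (force simp: e_def xpow_add Var_def)
  then have D: "oriented_edge_ideal E w = (ideal_gen (xpow ` e ` E) :: ('v, 'k) mpoly set)"
    by (simp add: oriented_edge_ideal_def)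
  have rad_e: "rad (e (x, y)) = Poly_Mapping.single x 1 + Poly_Mapping.single y 1" if "(x, y) \<in> E"
      for x y
  proof -
    have "x \<noteq> y" using that no_loop by blast
    then show ?thesis
      by (intro poly_mapping_eqI) (auto simp: rad_def keys_e lookup_add lookup_single when_def)
  qed
  have "{Var x * Var y |x y. {x, y} \<in> underlying_graph E} = (xpow ` rad ` e ` E :: ('v, 'k) mpoly set)"
    (is "?L = ?R")
  proof (intro equalityI subsetI)
    fix f assume "f \<in> ?L"
    then obtain x y where "f = Var x * Var y" "(x, y) \<in> E \<or> (y, x) \<in> E"
      by (auto simp: underlying_graph_def doubleton_eq_iff)
    then obtain a b where "f = Var a * Var b" "(a, b) \<in> E"
      by (metis mult.commute)
    then have "f = xpow (rad (e (a, b)))" by (simp add: rad_e xpow_add Var_def)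
    then show "f \<in> ?R" using \<open>(a, b) \<in> E\<close> by blast
  next
    fix f assume "f \<in> ?R"
    then obtain a b where "f = xpow (rad (e (a, b)))" "(a, b) \<in> E" by auto
    then have "f = Var a * Var b" "{a, b} \<in> underlying_graph E"
      by (auto simp: rad_e xpow_add Var_def underlying_graph_def)
    then show "f \<in> ?L" by blast
  qed
  then have G: "edge_ideal (underlying_graph E) =
      (ideal_gen (xpow ` rad ` e ` E) :: ('v, 'k) mpoly set)"
    by (simp add: edge_ideal_def)
  show ?thesis
    unfolding G
  proof (rule homological_linear_quotients_rad)
    have "card (keys (e (x, y))) = 2" if "(x, y) \<in> E" for x y
      unfolding keys_e using that no_loop by (intro card_2_iff[THEN iffD2]) blast
    then show "\<forall>u \<in> e ` E. card (keys u) = 2" by auto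
    \<comment> \<open>An edge carries one orientation only, so its two ends determine the oriented
      edge and thus the generator.\<close>
    show "inj_on rad (e ` E)"
    proof (rule inj_onI)
      fix a b assume "a \<in> e ` E" "b \<in> e ` E" "rad a = rad b"
      then obtain x y x' y' where xy: "a = e (x, y)" "b = e (x', y')" "(x, y) \<in> E" "(x', y') \<in> E"
        "{x, y} = {x', y'}"
        by (auto simp: rad_eq_iff keys_e)
      then have "(x, y) = (x', y')" using asym by (auto simp: doubleton_eq_iff)
      then show "a = b" using xy by simp
    qed
    show "homological_linear_quotients (ideal_gen (xpow ` e ` E) :: ('v, 'k) mpoly set)"
      using assms(2) D by simp
  qed simp
qed

end
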